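(* Let $C_1,C_2$ be real symmetric $3\times3$ matrices satisfying the standing assumptions (given in the context), let $\lambda_1>\lambda_2>\lambda_3>0$ be the eigenvalues of $C_1^{-1}C_2$, and let $e=\sqrt{\frac{\lambda_1-\lambda_2}{\lambda_1-\lambda_3}}$ be the pencil eccentricity. Then for each $\boldsymbol\nu=(\nu_1,\nu_2)\in\mathbb R^2$ with $\nu_2>0$ and $\nu_1+\lambda_3\nu_2>0$, the rotation number of the Poncelet map $P_{\boldsymbol\nu}:\mathcal C_1\to\mathcal C_1$ is $$\rho(\boldsymbol\nu)=\frac{F(\omega(\boldsymbol\nu),e)}{2K(e)},\qquad \omega(\boldsymbol\nu)=\arcsin\sqrt{\frac{(\lambda_1-\lambda_3)\,\nu_2}{\lambda_1\nu_2+\nu_1}}.$$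
   Context: A real symmetric $3\times3$ matrix $C$ defines the conic $\mathcal C=\{(x,y)\in\mathbb R^2:\mathbf u^TC\mathbf u=0,\ \mathbf u=(x,y,1)^T\}$. Standing assumptions on $(C_1,C_2)$: (i) for $i=1,2$ the upper-left $2\times2$ block of $C_i$ is positive definite and $\det C_i<0$; (ii) $C_1^{-1}C_2$ has three positive, distinct eigenvalues; (iii) whenever $\mathbf u\in\mathbb R^3$, $\mathbf u\ne0$ and $\mathbf u^TC_2\mathbf u=0$, then $\mathbf u^TC_1\mathbf u<0$ (the ellipse $\mathcal C_2$ is inside the ellipse $\mathcal C_1$). For $\boldsymbol\nu=(\nu_1,\nu_2)$ let $C_{\boldsymbol\nu}=\nu_1C_1+\nu_2C_2$, with conic $\mathcal C_{\boldsymbol\nu}$. If $\nu_2>0$ and $\nu_1+\lambda_3\nu_2>0$, then $\mathcal C_{\boldsymbol\nu}$ is an ellipse inside $\mathcal C_1$. Poncelet map: for such $\boldsymbol\nu$ and $z_0\in\mathcal C_1$, $P_{\boldsymbol\nu}(z_0)=z_1$ is the unique point of $\mathcal C_1$ such that the segment from $z_0$ to $z_1$ is tangent to $\mathcal C_{\boldsymbol\nu}$ with $\mathcal C_{\boldsymbol\nu}$ on the left when moving from $z_0$ to $z_1$. Elliptic integrals: $F(\phi,e)=\int_0^\phi\frac{d\tau}{\sqrt{1-e^2\sin^2\tau}}$ and $K(e)=F(\pi/2,e)$. Rotation number: $\mathcal C_1$ is oriented counterclockwise and identified with $\mathbb R/\mathbb Z$ by an orientation-preserving homeomorphism; the rotation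 number of an orientation-preserving circle homeomorphism with lift $G:\mathbb R\to\mathbb R$ is $\lim_{n\to\infty}(G^n(x)-x)/n$ modulo $1$, with the representative taken in $[0,1)$. *)

theory Defs
  imports "HOL-Complex_Analysis.Complex_Analysis"
begin

section \<open>Conics in the affine plane\<close>

text \<open>
  The plane \<open>\<real>\<^sup>2\<close> is identified with \<open>\<complex>\<close>, the point \<open>(x, y)\<close> being \<open>Complex x y\<close>, so that
  the library's \<^const>\<open>winding_number\<close> can express orientation.
\<close>

definition homog :: "complex \<Rightarrow> real ^ 3"
  where "homog z = vector [Re z, Im z, 1]"

definition conic_curve :: "real ^ 3 ^ 3 \<Rightarrow> complex set"
  where "conic_curve C = {z. homog z \<bullet> (C *v homog z) = 0}"

definition upper_left_block :: "real ^ 3 ^ 3 \<Rightarrow> real ^ 2 ^ 2"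
  where "upper_left_block C = vector [vector [C $ 1 $ 1, C $ 1 $ 2], vector [C $ 2 $ 1, C $ 2 $ 2]]"

definition positive_definite :: "real ^ 'n ^ 'n \<Rightarrow> bool"
  where "positive_definite A \<longleftrightarrow> (\<forall>v. v \<noteq> 0 \<longrightarrow> v \<bullet> (A *v v) > 0)"

definition eigenvalue :: "real ^ 'n ^ 'n \<Rightarrow> real \<Rightarrow> bool"
  where "eigenvalue A l \<longleftrightarrow> (\<exists>v. v \<noteq> 0 \<and> A *v v = l *\<^sub>R v)"

section \<open>The Poncelet map\<close>

text \<open>
  For symmetric \<open>C\<close> this is the tangent line of \<open>conic_curve C\<close> at its point \<open>p\<close>: the gradient of
  \<open>z \<mapsto> homog z \<bullet> (C *v homog z)\<close> at \<open>p\<close> consists of the first two entries of \<open>2 *\<^sub>R (C *v homog p)\<close>.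
\<close>

definition tangent_line :: "real ^ 3 ^ 3 \<Rightarrow> complex \<Rightarrow> complex set"
  where "tangent_line C p = {z. homog z \<bullet> (C *v homog p) = 0}"

definition segment_tangent_to :: "complex \<Rightarrow> complex \<Rightarrow> real ^ 3 ^ 3 \<Rightarrow> bool"
  where "segment_tangent_to z w C \<longleftrightarrow> z \<noteq> w \<and>
    (\<exists>p \<in> closed_segment z w. p \<in> conic_curve C \<and> {z, w} \<subseteq> tangent_line C p)"

text \<open>
  \<open>Im (cnj a * b)\<close> is the planar cross product \<open>Re a * Im b - Im a * Re b\<close>. The inequality is not
  strict because the line may touch the set.
\<close>

definition on_left :: "complex \<Rightarrow> complex \<Rightarrow> complex set \<Rightarrow> bool"
  where "on_left z w S \<longleftrightarrow> (\<forall>p \<in> S. Im (cnj (w - z) * (p - z)) \<ge> 0)"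

definition poncelet_map :: "real ^ 3 ^ 3 \<Rightarrow> real ^ 3 ^ 3 \<Rightarrow> complex \<Rightarrow> complex"
  where "poncelet_map A C z =
    (THE w. w \<in> conic_curve A \<and> segment_tangent_to z w C \<and> on_left z w (conic_curve C))"

section \<open>Elliptic integrals\<close>

text \<open>Here \<open>e\<close> is the modulus. The interval integral is oriented, so negative \<open>\<phi>\<close> is covered.\<close>

definition elliptic_F :: "real \<Rightarrow> real \<Rightarrow> real"
  where "elliptic_F \<phi> e = (LBINT \<tau>=ereal 0..ereal \<phi>. 1 / sqrt (1 - e\<^sup>2 * (sin \<tau>)\<^sup>2))"

definition elliptic_K :: "real \<Rightarrow> real"
  where "elliptic_K e = elliptic_F (pi / 2) e"

section \<open>Rotation number on a closed curve\<close>

text \<open>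
  \<open>h\<close> induces a homeomorphism from \<open>\<real>/\<int>\<close> onto the Jordan curve \<open>S\<close> (a continuous bijection
  from a compact space) preserving orientation when \<open>S\<close> is oriented counterclockwise. Only
  \<open>h\<close> on \<open>[0, 1]\<close> enters the winding number.
\<close>

definition ccw_parametrization :: "complex set \<Rightarrow> (real \<Rightarrow> complex) \<Rightarrow> bool"
  where "ccw_parametrization S h \<longleftrightarrow>
    continuous_on UNIV h \<and> range h = S \<and> (\<forall>s t. h s = h t \<longleftrightarrow> s - t \<in> \<int>) \<and>
    (\<forall>z \<in> inside S. winding_number h z = 1)"

text \<open>
  A self-map \<open>f\<close> of the curve is an orientation-preserving homeomorphism exactly if it has
  a lift of this form.
\<close>

definition circle_lift :: "(real \<Rightarrow> complex) \<Rightarrow> (complex \<Rightarrow> complex) \<Rightarrow> (real \<Rightarrow> real) \<Rightarrow> bool"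
  where "circle_lift h f G \<longleftrightarrow>
    continuous_on UNIV G \<and> strict_mono G \<and> (\<forall>x. G (x + 1) = G x + 1) \<and> (\<forall>x. h (G x) = f (h x))"

text \<open>
  The first conjunct says that \<open>f\<close> is an orientation-preserving homeomorphism of \<open>S\<close>; the second
  that the value is \<open>\<rho>\<close> for every choice of parametrization, lift and base point.
\<close>

definition has_rotation_number :: "complex set \<Rightarrow> (complex \<Rightarrow> complex) \<Rightarrow> real \<Rightarrow> bool"
  where "has_rotation_number S f \<rho> \<longleftrightarrow>
    (\<exists>h G. ccw_parametrization S h \<and> circle_lift h f G) \<and>
    (\<forall>h G x. ccw_parametrization S h \<and> circle_lift h f G \<longrightarrow>
      (\<exists>L. (\<lambda>n. ((G ^^ n) x - x) / real n) \<longlonglongrightarrow> L \<and> frac L = \<rho>))"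

end

theory Submission
  imports Defs
begin

text \<open>
  The pencil spanned by \<open>C1\<close> and \<open>C2\<close> has a common self-polar triangle: eigenvectors \<open>v1\<close>, \<open>v2\<close>,
  \<open>v3\<close> of the pencil are orthogonal for both quadratic forms. In the homogeneous coordinates
  \<open>(x : y : w)\<close> that belong to them the first conic is the unit circle \<open>x\<^sup>2 + y\<^sup>2 = w\<^sup>2\<close> and
  \<open>\<nu>\<^sub>1 C1 + \<nu>\<^sub>2 C2\<close> is the ellipse \<open>a x\<^sup>2 + b y\<^sup>2 = c w\<^sup>2\<close> with \<open>a = \<nu>\<^sub>1 + l\<^sub>1 \<nu>\<^sub>2\<close>, \<open>b = \<nu>\<^sub>1 + l\<^sub>2 \<nu>\<^sub>2\<close>,
  \<open>c = \<nu>\<^sub>1 + l\<^sub>3 \<nu>\<^sub>2\<close>, so \<open>0 < c < b < a\<close> (\<open>self_polar_triangle_exists\<close>). The change of coordinates is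
  projective and not affine, but \<open>w > 0\<close> on the closed disc bounded by the first conic, and the
  vectors can be chosen positively oriented. Hence segments inside the disc, tangency, and the
  relation of lying on the left can all be read off in these coordinates.

  Let \<open>m - d\<close> and \<open>m + d\<close> be the angles of two points of the circle. Their chord touches the
  ellipse, with the ellipse on its left, exactly if \<open>0 < d < \<pi>/2\<close> and
  \<open>cos\<^sup>2 d = c (cos\<^sup>2 m / a + sin\<^sup>2 m / b)\<close>; then the Poncelet map sends the point at \<open>m - d\<close> to the
  point at \<open>m + d\<close> (\<open>poncelet_map_tangent_chord\<close>). Regard \<open>d\<close> as a function of \<open>m\<close>. The square roots
  \<open>R\<^sub>1\<close>, \<open>R\<^sub>2\<close> of \<open>a cos\<^sup>2 t + b sin\<^sup>2 t - c\<close> at the two ends satisfy \<open>d' = (R\<^sub>2 - R\<^sub>1) / (R\<^sub>1 + R\<^sub>2)\<close>,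
  which says \<open>(1 + d') / R\<^sub>2 = (1 - d') / R\<^sub>1\<close>: the measure \<open>dt / R(t)\<close> is invariant under the Poncelet
  map. Up to a constant factor it is the differential of \<open>F(t, e)\<close>. Thus \<open>F\<close> increases along every
  tangent chord by the same amount, and the chord with \<open>m = 0\<close>, which joins \<open>-\<omega>\<close> to \<open>\<omega>\<close>, shows that
  this amount is \<open>2 F(\<omega>, e)\<close> (\<open>elliptic_F_tangent_chord\<close>). A full turn increases \<open>F\<close> by \<open>4 K(e)\<close>, so in
  the coordinate \<open>F / (4 K)\<close> the Poncelet map is the rotation by \<open>F(\<omega>, e) / (2 K(e))\<close>.

  That this number does not depend on the parametrization and the lift is a general fact
  (\<open>has_rotation_number_of_rotation_coordinate\<close>). Two counterclockwise parametrizations of a Jordan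
  curve differ by a map of degree one, since the winding number detects the degree; and a map of
  degree one stays within bounded distance of the identity, so it does not affect the limit.
\<close>

section \<open>Parametrizations of a closed curve and their lifts\<close>

lemma continuous_Ints_valued_constant:
  fixes f :: "real \<Rightarrow> real"
  assumes "continuous_on UNIV f" and "\<And>x. f x \<in> \<int>"
  obtains k :: int where "\<And>x. f x = of_int k"
proof -
  have "f constant_on UNIV"
  proof (rule continuous_discrete_range_constant)
    fix x :: real
    have "1 \<le> norm (f y - f x)" if "f y \<noteq> f x" for y
      using that assms(2)[of x] assms(2)[of y] by (auto elim!: Ints_cases simp flip: of_int_diff)
    then show "\<exists>e>0. \<forall>y. y \<in> UNIV \<and> f y \<noteq> f x \<longrightarrow> e \<le> norm (f y - f x)"
      by (intro exI[of _ 1]) auto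
  qed (use assms in auto)
  then obtain c where "\<And>x. f x = c"
    by (auto simp: constant_on_def)
  moreover obtain k where "c = of_int k"
    using assms(2)[of 0] \<open>\<And>x. f x = c\<close> by (metis Ints_cases)
  ultimately show ?thesis
    using that by simp
qed

text \<open>
  The winding number of a curve, closed or not, is the increment of any continuous logarithm of
  \<open>p - z\<close>; this makes it computable along reparametrized curves.
\<close>

lemma winding_number_eq_log_increment:
  assumes "continuous_on {0..1} l" and "\<And>t. t \<in> {0..1} \<Longrightarrow> p t - z = exp (l t)"
  shows "winding_number p z = (l 1 - l 0) / (2 * of_real pi * \<i>)"
proof -
  have "winding_number p z = winding_number (\<lambda>t. p t - z) 0"
    by (rule winding_number_offset)
  also have "\<dots> = winding_number (exp \<circ> l) 0"
    by (rule winding_number_cong) (use assms in auto)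
  also have "\<dots> = (l 1 - l 0) / (2 * of_real pi * \<i>)"
    using winding_number_compose_exp[of l] assms(1)
    by (simp add: path_def pathfinish_def pathstart_def)
  finally show ?thesis .
qed

text \<open>
  The part of a counterclockwise parametrization that ignores orientation. It already makes \<open>h\<close>
  a simple closed path, which is needed before its winding numbers can be determined.
\<close>

definition circle_parametrization :: "complex set \<Rightarrow> (real \<Rightarrow> complex) \<Rightarrow> bool"
  where "circle_parametrization S h \<longleftrightarrow>
    continuous_on UNIV h \<and> range h = S \<and> (\<forall>s t. h s = h t \<longleftrightarrow> s - t \<in> \<int>)"

lemma ccw_parametrization_altdef:
  "ccw_parametrization S h \<longleftrightarrow>
    circle_parametrization S h \<and> (\<forall>z \<in> inside S. winding_number h z = 1)"
  by (auto simp: ccw_parametrization_def circle_parametrization_def)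

lemma circle_parametrization_shift:
  assumes "circle_parametrization S h"
  shows "h (t + of_int k) = h t"
  using assms unfolding circle_parametrization_def by (metis Ints_of_int add_diff_cancel_left')

lemma circle_parametrization_image_unit_interval:
  assumes "circle_parametrization S h"
  shows "h ` {0..1} = S"
proof -
  have "h t \<in> h ` {0..1}" for t
    using circle_parametrization_shift[OF assms, of "frac t" "\<lfloor>t\<rfloor>"] frac_lt_1[of t] frac_ge_0[of t]
    by (intro image_eqI[of _ _ "frac t"]) (auto simp: frac_def less_eq_real_def)
  then show ?thesis
    using assms unfolding circle_parametrization_def by blast
qed

lemma circle_parametrization_simple_loop:
  assumes "circle_parametrization S h"
  shows "simple_path h" and "pathfinish h = pathstart h" and "path_image h = S"
proof -
  show "path_image h = S"
    using circle_parametrization_image_unit_interval[OF assms] by (simp add: path_image_def)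
  show "pathfinish h = pathstart h"
    using circle_parametrization_shift[OF assms, of 0 1] by (simp add: pathfinish_def pathstart_def)
  have "x = y \<or> x = 0 \<and> y = 1 \<or> x = 1 \<and> y = 0"
    if "x \<in> {0..1}" "y \<in> {0..1}" "h x = h y" for x y
  proof -
    have "x - y \<in> \<int>"
      using that assms by (simp add: circle_parametrization_def)
    then obtain k :: int where "x - y = of_int k"
      by (rule Ints_cases)
    moreover from this have "k \<le> 1 \<and> -1 \<le> k"
      using that by auto
    then have "k = -1 \<or> k = 0 \<or> k = 1"
      by presburger
    ultimately show ?thesis
      using that by auto
  qed
  moreover have "continuous_on {0..1} h"
    using assms by (auto simp: circle_parametrization_def intro: continuous_on_subset)
  ultimately show "simple_path h"
    unfolding simple_path_def loop_free_def path_def by blast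
qed

text \<open>
  The inverse of the induced map from the circle to \<open>S\<close>. It is continuous because \<open>h\<close> maps the
  compact interval \<open>[0, 1]\<close> onto \<open>S\<close>, so that images of closed subsets are closed.
\<close>

lemma circle_parametrization_angle:
  assumes "circle_parametrization S h"
  obtains \<kappa> :: "complex \<Rightarrow> complex"
  where "continuous_on S \<kappa>" and "\<And>t. \<kappa> (h t) = cis (2 * pi * t)"
proof -
  define \<kappa> where "\<kappa> p = cis (2 * pi * (SOME t. h t = p))" for p
  have \<kappa>: "\<kappa> (h t) = cis (2 * pi * t)" for t
  proof -
    have "h (SOME s. h s = h t) = h t"
      by (rule someI) simp
    then have "(SOME s. h s = h t) - t \<in> \<int>"
      using assms by (simp add: circle_parametrization_def)
    then obtain k :: int where "(SOME s. h s = h t) - t = of_int k"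
      by (rule Ints_cases)
    then have "(SOME s. h s = h t) = t + of_int k"
      by simp
    then have "\<kappa> (h t) = cis (2 * pi * t + 2 * pi * of_int k)"
      by (simp add: \<kappa>_def algebra_simps)
    also have "\<dots> = cis (2 * pi * t)"
      using sin_cos_eq_iff by (auto simp: complex_eq_iff)
    finally show ?thesis .
  qed
  have cont: "continuous_on {0..1} h"
    using assms by (auto simp: circle_parametrization_def intro: continuous_on_subset)
  have "continuous_on S \<kappa>"
    unfolding continuous_on_closed_invariant
  proof (intro allI impI)
    fix B :: "complex set" assume "closed B"
    have "continuous_on {0..1} (\<lambda>t. cis (2 * pi * t))"
      by (intro continuous_intros)
    then have "closed ((\<lambda>t. cis (2 * pi * t)) -` B \<inter> {0..1})"
      using \<open>closed B\<close> continuous_closed_preimage by (metis Int_commute closed_real_atLeastAtMost)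
    then have "compact ((\<lambda>t. cis (2 * pi * t)) -` B \<inter> {0..1})"
      by (auto simp: compact_eq_bounded_closed intro: bounded_subset[OF bounded_closed_interval])
    then have "compact (h ` ((\<lambda>t. cis (2 * pi * t)) -` B \<inter> {0..1}))"
      by (intro compact_continuous_image continuous_on_subset[OF cont]) auto
    moreover have "h ` ((\<lambda>t. cis (2 * pi * t)) -` B \<inter> {0..1}) \<inter> S = \<kappa> -` B \<inter> S"
      using circle_parametrization_image_unit_interval[OF assms] \<kappa> by auto
    ultimately show "\<exists>A. closed A \<and> A \<inter> S = \<kappa> -` B \<inter> S"
      using compact_imp_closed by blast
  qed
  then show ?thesis
    using \<kappa> that by blast
qed

text \<open>
  A logarithm of the angle of \<open>h t\<close> on the curve \<open>\<gamma>\<close> gives a continuous \<open>g\<close> with \<open>h = \<gamma> \<circ> g\<close>, and then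
  \<open>g (t + 1) - g t\<close> is a constant integer \<open>k\<close>. Around an inside point the curve \<open>h\<close> winds \<open>k\<close> times as
  often as \<open>\<gamma>\<close>; both winding numbers are 1, so \<open>k = 1\<close>. Without the orientation condition
  \<open>k = -1\<close> would be possible.
\<close>

lemma ccw_parametrization_lift:
  assumes \<gamma>: "ccw_parametrization S \<gamma>" and h: "ccw_parametrization S h"
  obtains g where "continuous_on UNIV g" and "\<And>t. h t = \<gamma> (g t)" and "\<And>t. g (t + 1) = g t + 1"
proof -
  note \<gamma>' = \<gamma>[unfolded ccw_parametrization_altdef, THEN conjunct1]
  note h' = h[unfolded ccw_parametrization_altdef, THEN conjunct1]
  obtain \<kappa> where \<kappa>: "continuous_on S \<kappa>" "\<And>t. \<kappa> (\<gamma> t) = cis (2 * pi * t)"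
    using circle_parametrization_angle[OF \<gamma>'] by blast
  have conth: "continuous_on UNIV h" and rh: "range h = S"
    using h by (auto simp: ccw_parametrization_def)
  have cont\<gamma>: "continuous_on UNIV \<gamma>" and r\<gamma>: "range \<gamma> = S"
    using \<gamma> by (auto simp: ccw_parametrization_def)
  have norm: "norm (\<kappa> (h t)) = 1" for t
    using \<kappa>(2) rh r\<gamma> by (metis norm_cis rangeE rangeI)
  have "continuous_on UNIV (\<lambda>t. \<kappa> (h t))"
    using \<kappa>(1) conth rh by (intro continuous_on_compose2[of S \<kappa> UNIV h]) auto
  moreover have "\<kappa> (h t) \<noteq> 0" for t
    using norm[of t] by auto
  ultimately obtain q where q: "continuous_on UNIV q" "\<And>t. \<kappa> (h t) = exp (q t)"
    using continuous_logarithm_on_contractible[of UNIV "\<lambda>t. \<kappa> (h t)"] convex_imp_contractible by auto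
  \<comment> \<open>\<open>q\<close> is purely imaginary because \<open>\<kappa>\<close> takes values on the unit circle.\<close>
  define g where "g t = Im (q t) / (2 * pi)" for t
  have g: "continuous_on UNIV g"
    unfolding g_def using q(1) by (auto intro!: continuous_intros)
  have hg: "h t = \<gamma> (g t)" for t
  proof -
    obtain s where s: "h t = \<gamma> s"
      using rh r\<gamma> by (metis rangeE rangeI)
    have "Re (q t) = 0"
      using norm[of t] by (simp add: q(2))
    then have "cis (2 * pi * s) = cis (2 * pi * g t)"
      using q(2)[of t] \<kappa>(2)[of s] s by (simp add: g_def exp_eq_polar)
    then obtain k :: int where "2 * pi * s = 2 * pi * g t + 2 * pi * of_int k"
      using sin_cos_eq_iff[of "2 * pi * s" "2 * pi * g t"] by (auto simp: complex_eq_iff)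
    then have "2 * pi * s = 2 * pi * (g t + of_int k)"
      by (simp add: algebra_simps)
    then have "s = g t + of_int k"
      by simp
    then show ?thesis
      using s circle_parametrization_shift[OF \<gamma>'] by simp
  qed
  have "g (t + 1) - g t \<in> \<int>" for t
    using hg[of t] hg[of "t + 1"] circle_parametrization_shift[OF h', of t 1] \<gamma>
    by (metis ccw_parametrization_def of_int_1)
  moreover have "continuous_on UNIV (\<lambda>t. g (t + 1) - g t)"
    by (intro continuous_on_diff g continuous_on_compose2[OF g] continuous_on_add continuous_on_id continuous_on_const) auto
  ultimately obtain k :: int where k: "\<And>t. g (t + 1) - g t = of_int k"
    using continuous_Ints_valued_constant[of "\<lambda>t. g (t + 1) - g t"] by blast
  obtain z where z: "z \<in> inside S"
    using Jordan_inside_outside[of \<gamma>] circle_parametrization_simple_loop[OF \<gamma>'] by auto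
  then have zS: "z \<notin> S"
    using inside_no_overlap by blast
  have "continuous_on UNIV (\<lambda>t. \<gamma> t - z)" "\<And>t. \<gamma> t - z \<noteq> 0"
    using cont\<gamma> zS r\<gamma> by (auto intro!: continuous_intros)
  then obtain l where l: "continuous_on UNIV l" "\<And>t. \<gamma> t - z = exp (l t)"
    using continuous_logarithm_on_contractible[of UNIV "\<lambda>t. \<gamma> t - z"] convex_imp_contractible by auto
  have "(l 1 - l 0) / (2 * of_real pi * \<i>) = 1"
    using winding_number_eq_log_increment[OF continuous_on_subset[OF l(1)], of \<gamma> z] l(2) z \<gamma>
    by (auto simp: ccw_parametrization_def)
  then have l01: "l 1 - l 0 = 2 * of_real pi * \<i>"
    by simp
  define w where "w t = Im (l (t + 1) - l t) / (2 * pi)" for t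
  have lw: "l (t + 1) = l t + 2 * of_real pi * \<i> * of_real (w t) \<and> w t \<in> \<int>" for t
  proof -
    have "exp (l (t + 1)) = exp (l t)"
      using l(2)[of t] l(2)[of "t + 1"] circle_parametrization_shift[OF \<gamma>', of t 1] by simp
    then obtain n :: int where "l (t + 1) = l t + (of_int (2 * n) * pi) * \<i>"
      by (auto simp: exp_eq)
    then show ?thesis
      by (auto simp: w_def complex_eq_iff)
  qed
  have "continuous_on UNIV w"
    unfolding w_def divide_inverse
    by (intro continuous_on_mult continuous_on_Im continuous_on_diff continuous_on_const l(1)
        continuous_on_compose2[OF l(1)] continuous_on_add continuous_on_id) auto
  then obtain n :: int where n: "\<And>t. w t = of_int n"
    using continuous_Ints_valued_constant lw by metis
  have "w 0 = 1"
    using l01 by (simp add: w_def)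
  then have step: "l (t + 1) = l t + 2 * of_real pi * \<i>" for t
    using lw[of t] n[of t] n[of 0] by simp
  \<comment> \<open>Going once around \<open>\<gamma>\<close> adds \<open>2 \<pi> \<i>\<close> to the logarithm \<open>l\<close> from any starting point, not only from 0.\<close>
  have l_nat: "l (t + of_nat m) = l t + 2 * of_real pi * \<i> * of_nat m" for t m
  proof (induction m)
    case (Suc m)
    then show ?case
      using step[of "t + of_nat m"] by (simp add: algebra_simps)
  qed simp
  have l_int: "l (t + of_int m) = l t + 2 * of_real pi * \<i> * of_int m" for t m
  proof (cases "m \<ge> 0")
    case True
    then show ?thesis
      using l_nat[of t "nat m"] by simp
  next
    case False
    then show ?thesis
      using l_nat[of "t + of_int m" "nat (- m)"] by (simp add: algebra_simps)
  qed
  have "continuous_on {0..1} (\<lambda>t. l (g t))"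
    by (rule continuous_on_compose2[OF l(1) continuous_on_subset[OF g]]) auto
  then have "winding_number h z = (l (g 1) - l (g 0)) / (2 * of_real pi * \<i>)"
    using l(2) hg by (intro winding_number_eq_log_increment) auto
  moreover have "winding_number h z = 1"
    using h z by (simp add: ccw_parametrization_def)
  moreover have "g 1 = g 0 + of_int k"
    using k[of 0] by simp
  ultimately have "(of_int k :: complex) = 1"
    using l_int[of "g 0" k] by simp
  then have "k = 1"
    by simp
  then have "g (t + 1) = g t + 1" for t
    using k[of t] by simp
  then show ?thesis
    using that g hg by blast
qed

section \<open>Rotation numbers in a coordinate where the map is a rotation\<close>

lemma degree_one_of_int:
  fixes B :: "real \<Rightarrow> real"
  assumes "\<And>t. B (t + 1) = B t + 1"
  shows "B (t + of_int k) = B t + of_int k"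
proof -
  have nat: "B (t + of_nat n) = B t + of_nat n" for t n
  proof (induction n)
    case (Suc n)
    then show ?case
      using assms[of "t + of_nat n"] by (simp add: algebra_simps)
  qed simp
  show ?thesis
  proof (cases "k \<ge> 0")
    case True
    then show ?thesis
      using nat[of t "nat k"] by simp
  next
    case False
    then show ?thesis
      using nat[of "t + of_int k" "nat (- k)"] by simp
  qed
qed

lemma degree_one_surj:
  fixes B :: "real \<Rightarrow> real"
  assumes "continuous_on UNIV B" and "\<And>t. B (t + 1) = B t + 1"
  shows "surj B"
proof -
  have "\<exists>t. B t = y" for y
  proof -
    define n :: int where "n = \<lceil>\<bar>y - B 0\<bar>\<rceil>"
    have n: "\<bar>y - B 0\<bar> \<le> of_int n"
      by (simp add: n_def)
    have "B (of_int (- n)) \<le> y" "y \<le> B (of_int n)"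
      using degree_one_of_int[of B 0, OF assms(2)] n by (simp_all add: abs_le_iff flip: of_int_minus)
    moreover have "of_int (- n) \<le> (of_int n :: real)"
      using n by simp
    ultimately show ?thesis
      using IVT'[of B "of_int (- n)" y "of_int n"] continuous_on_subset[OF assms(1)] by blast
  qed
  then show ?thesis
    by (metis surjI)
qed

lemma degree_one_bounded_displacement:
  fixes B :: "real \<Rightarrow> real"
  assumes "continuous_on UNIV B" and "\<And>t. B (t + 1) = B t + 1"
  obtains M where "\<And>t. \<bar>B t - t\<bar> \<le> M"
proof -
  have "continuous_on {0..1} (\<lambda>t. B t - t)"
    by (intro continuous_on_diff continuous_on_subset[OF assms(1)] continuous_on_id) auto
  then have "bounded ((\<lambda>t. B t - t) ` {0..1})"
    by (intro compact_imp_bounded compact_continuous_image) auto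
  then obtain M where M: "\<And>t. t \<in> {0..1} \<Longrightarrow> \<bar>B t - t\<bar> \<le> M"
    unfolding bounded_iff by (metis image_eqI real_norm_def)
  have "\<bar>B t - t\<bar> \<le> M" for t
  proof -
    have "B t - t = B (frac t) - frac t"
      using degree_one_of_int[of B "frac t" "\<lfloor>t\<rfloor>", OF assms(2)] by (simp add: frac_def)
    then show ?thesis
      using M[of "frac t"] frac_ge_0[of t] frac_lt_1[of t] by simp
  qed
  then show ?thesis
    using that by blast
qed

text \<open>
  In the coordinate \<open>\<beta>\<close> the iterates of \<open>G\<close> advance by exactly \<open>n * c\<close>. Changing back to the original
  coordinate costs a bounded error, which disappears after division by \<open>n\<close>.
\<close>

lemma translation_number_of_semiconjugacy:
  fixes \<beta> G :: "real \<Rightarrow> real"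
  assumes "continuous_on UNIV \<beta>" and "\<And>t. \<beta> (t + 1) = \<beta> t + 1"
    and semi: "\<And>t. \<beta> (G t) = \<beta> t + c"
  shows "(\<lambda>n. ((G ^^ n) x - x) / real n) \<longlonglongrightarrow> c"
proof -
  obtain M where M: "\<And>t. \<bar>\<beta> t - t\<bar> \<le> M"
    using degree_one_bounded_displacement[OF assms(1,2)] by blast
  have iter: "\<beta> ((G ^^ n) x) = \<beta> x + of_nat n * c" for n
    by (induction n) (simp_all add: semi algebra_simps)
  define r where "r n = ((\<beta> x - x) - (\<beta> ((G ^^ n) x) - (G ^^ n) x)) / real n" for n
  have "(\<lambda>n. r n) \<longlonglongrightarrow> 0"
  proof (rule Lim_null_comparison)
    have "norm (r n) \<le> 2 * M / real n" for n
    proof -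
      have "\<bar>(\<beta> x - x) - (\<beta> ((G ^^ n) x) - (G ^^ n) x)\<bar> \<le> 2 * M"
        using M[of x] M[of "(G ^^ n) x"] by linarith
      then show ?thesis
        by (simp add: r_def divide_right_mono)
    qed
    then show "\<forall>\<^sub>F n in sequentially. norm (r n) \<le> 2 * M / real n"
      by simp
    show "(\<lambda>n. 2 * M / real n) \<longlonglongrightarrow> 0"
      by (rule lim_const_over_n)
  qed
  then have "(\<lambda>n. c + r n) \<longlonglongrightarrow> c + 0"
    by (intro tendsto_add tendsto_const)
  moreover have "\<forall>\<^sub>F n in sequentially. c + r n = ((G ^^ n) x - x) / real n"
    using eventually_gt_at_top[of 0]
  proof eventually_elim
    case (elim n)
    then show ?case
      using iter[of n] by (simp add: r_def field_simps)
  qed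
  ultimately show ?thesis
    using tendsto_cong by force
qed

text \<open>
  If \<open>f\<close> is the rotation by \<open>\<rho>\<close> in the coordinate \<open>B\<close>, conjugating the translation by \<open>\<rho>\<close> with \<open>B\<close>
  gives a lift of \<open>f\<close> for \<open>\<gamma>\<close>. For another parametrization \<open>h = \<gamma> \<circ> g\<close>, a lift is turned by
  \<open>B \<circ> g\<close> into a translation by \<open>\<rho> + m\<close> for some integer \<open>m\<close>.
\<close>

lemma has_rotation_number_of_rotation_coordinate:
  assumes \<gamma>: "ccw_parametrization S \<gamma>"
    and B: "continuous_on UNIV B" "strict_mono B" "\<And>t. B (t + 1) = B t + 1"
    and \<rho>: "0 \<le> \<rho>" "\<rho> < 1"
    and f: "\<And>s t. B s = B t + \<rho> \<Longrightarrow> f (\<gamma> t) = \<gamma> s"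
  shows "has_rotation_number S f \<rho>"
proof -
  have surj: "surj B"
    using degree_one_surj[OF B(1,3)] .
  have inj: "inj B"
    using B(2) strict_mono_imp_inj_on by blast
  define G where "G t = inv B (B t + \<rho>)" for t
  have BG: "B (G t) = B t + \<rho>" for t
    by (simp add: G_def surj surj_f_inv_f)
  have fG: "f (\<gamma> t) = \<gamma> (G t)" for t
    by (rule f[OF BG])
  have "isCont (inv B) (B x)" for x
    using B(1) inj by (intro isCont_inverse_function[where d = 1 and f = B and g = "inv B"]) (auto simp: continuous_on_eq_continuous_at)
  then have "continuous_on UNIV (inv B)"
    using surj by (auto simp: continuous_on_eq_continuous_at) (metis surjD)
  then have G: "continuous_on UNIV G"
    unfolding G_def
    by (rule continuous_on_compose2) (auto intro!: continuous_on_add B(1) continuous_on_const)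
  have monoG: "strict_mono G"
    by (rule strict_monoI) (metis B(2) BG add_less_cancel_right strict_mono_less)
  have perG: "G (t + 1) = G t + 1" for t
    by (rule injD[OF inj]) (simp add: BG B(3))
  have "circle_lift \<gamma> f G"
    using G monoG perG fG by (simp add: circle_lift_def)
  moreover have "\<exists>L. (\<lambda>n. ((G' ^^ n) x - x) / real n) \<longlonglongrightarrow> L \<and> frac L = \<rho>"
    if h: "ccw_parametrization S h" and G': "circle_lift h f G'" for h G' x
  proof -
    obtain g where g: "continuous_on UNIV g" "\<And>t. h t = \<gamma> (g t)" "\<And>t. g (t + 1) = g t + 1"
      using ccw_parametrization_lift[OF \<gamma> h] by blast
    have "g (G' t) - G (g t) \<in> \<int>" for t
    proof -
      have "\<gamma> (g (G' t)) = \<gamma> (G (g t))"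
        using G' fG[of "g t"] g(2) by (simp add: circle_lift_def)
      then show ?thesis
        using \<gamma> by (simp add: ccw_parametrization_def)
    qed
    moreover have "continuous_on UNIV (\<lambda>t. g (G' t) - G (g t))"
      using G' by (intro continuous_on_diff continuous_on_compose2[OF g(1)] continuous_on_compose2[OF G] g(1))
        (auto simp: circle_lift_def)
    ultimately obtain m :: int where m: "\<And>t. g (G' t) - G (g t) = of_int m"
      using continuous_Ints_valued_constant[of "\<lambda>t. g (G' t) - G (g t)"] by blast
    have "B (g (G' t)) = B (g t) + (\<rho> + of_int m)" for t
    proof -
      have "g (G' t) = G (g t) + of_int m"
        using m[of t] by simp
      then show ?thesis
        using degree_one_of_int[of B, OF B(3)] BG by simp
    qed
    moreover have "continuous_on UNIV (\<lambda>t. B (g t))"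
      by (intro continuous_on_compose2[OF B(1)] g(1)) auto
    ultimately have "(\<lambda>n. ((G' ^^ n) x - x) / real n) \<longlonglongrightarrow> \<rho> + of_int m"
      using g(3) B(3) by (intro translation_number_of_semiconjugacy[of "\<lambda>t. B (g t)"]) auto
    moreover have "frac (\<rho> + of_int m) = \<rho>"
      using \<rho> by (simp add: frac_unique_iff)
    ultimately show ?thesis
      by blast
  qed
  ultimately show ?thesis
    using \<gamma> unfolding has_rotation_number_def by blast
qed

section \<open>Incomplete elliptic integrals of the first kind\<close>

lemma elliptic_F_0 [simp]: "elliptic_F 0 e = 0"
  by (simp add: elliptic_F_def)

lemma elliptic_integrand_pos:
  fixes e t :: real
  assumes "e\<^sup>2 < 1"
  shows "0 < 1 - e\<^sup>2 * (sin t)\<^sup>2"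
proof -
  have "e\<^sup>2 * (sin t)\<^sup>2 \<le> e\<^sup>2 * 1"
    by (intro mult_left_mono) (auto simp: abs_square_le_1)
  then show ?thesis
    using assms by simp
qed

lemma elliptic_F_has_derivative:
  assumes "e\<^sup>2 < 1"
  shows "((\<lambda>\<phi>. elliptic_F \<phi> e) has_real_derivative 1 / sqrt (1 - e\<^sup>2 * (sin x)\<^sup>2)) (at x)"
proof -
  define f where "f t = 1 / sqrt (1 - e\<^sup>2 * (sin t)\<^sup>2)" for t :: real
  define a where "a = - \<bar>x\<bar> - 1"
  define b where "b = \<bar>x\<bar> + 1"
  have "continuous_on {a..b} f"
    unfolding f_def using elliptic_integrand_pos[OF assms] 
    by (intro continuous_intros) (auto simp: less_le)
  then have "((\<lambda>u. LBINT y=ereal 0..ereal u. f y) has_vector_derivative f x) (at x within {a..b})"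
    by (intro interval_integral_FTC2) (auto simp: a_def b_def)
  moreover have "at x within {a..b} = at x"
    by (rule at_within_interior) (auto simp: a_def b_def)
  ultimately show ?thesis
    by (simp add: elliptic_F_def f_def has_real_derivative_iff_has_vector_derivative)
qed

lemma continuous_on_elliptic_F:
  assumes "e\<^sup>2 < 1"
  shows "continuous_on S (\<lambda>\<phi>. elliptic_F \<phi> e)"
  using elliptic_F_has_derivative[OF assms]
  by (meson DERIV_continuous continuous_at_imp_continuous_on)

lemma strict_mono_elliptic_F:
  assumes "e\<^sup>2 < 1"
  shows "strict_mono (\<lambda>\<phi>. elliptic_F \<phi> e)"
proof (rule strict_monoI)
  fix x y :: real assume "x < y"
  then show "elliptic_F x e < elliptic_F y e"
    using elliptic_F_has_derivative[OF assms] elliptic_integrand_pos[OF assms]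
    by (intro DERIV_pos_imp_increasing[of x y "\<lambda>\<phi>. elliptic_F \<phi> e"]) (auto intro!: exI)
qed

lemma elliptic_F_minus:
  assumes "e\<^sup>2 < 1"
  shows "elliptic_F (- x) e = - elliptic_F x e"
proof -
  have "((\<lambda>x. elliptic_F (- x) e + elliptic_F x e) has_real_derivative 0) (at x)" for x
    by (rule derivative_eq_intros DERIV_chain2[OF elliptic_F_has_derivative[OF assms]]
        elliptic_F_has_derivative[OF assms] refl)+ simp
  then have "elliptic_F (- x) e + elliptic_F x e = elliptic_F (- 0) e + elliptic_F 0 e"
    by (intro DERIV_isconst_all) blast
  then show ?thesis
    by simp
qed

lemma elliptic_F_add_pi:
  assumes "e\<^sup>2 < 1"
  shows "elliptic_F (x + pi) e = elliptic_F x e + 2 * elliptic_K e"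
proof -
  have "((\<lambda>x. elliptic_F (x + pi) e - elliptic_F x e) has_real_derivative 0) (at x)" for x
    by (rule derivative_eq_intros DERIV_chain2[OF elliptic_F_has_derivative[OF assms]]
        elliptic_F_has_derivative[OF assms] refl)+ simp
  then have "elliptic_F (x + pi) e - elliptic_F x e
      = elliptic_F (- (pi / 2) + pi) e - elliptic_F (- (pi / 2)) e"
    by (intro DERIV_isconst_all) blast
  then show ?thesis
    using elliptic_F_minus[OF assms, of "pi / 2"] by (simp add: elliptic_K_def)
qed

lemma elliptic_F_add_2pi:
  assumes "e\<^sup>2 < 1"
  shows "elliptic_F (x + 2 * pi) e = elliptic_F x e + 4 * elliptic_K e"
  using elliptic_F_add_pi[OF assms, of x] elliptic_F_add_pi[OF assms, of "x + pi"]
  by (simp add: algebra_simps)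

lemma elliptic_K_pos:
  assumes "e\<^sup>2 < 1"
  shows "0 < elliptic_K e"
  using strict_monoD[OF strict_mono_elliptic_F[OF assms], of 0 "pi / 2"]
  by (simp add: elliptic_K_def)

section \<open>Chords of the unit circle tangent to an ellipse inside it\<close>

text \<open>
  The ellipse \<open>a x\<^sup>2 + b y\<^sup>2 = c\<close> lies inside the unit circle, and its shorter axis is the \<open>x\<close>-axis.
\<close>

locale inner_ellipse =
  fixes a b c :: real
  assumes c_pos: "0 < c" and c_less_b: "c < b" and b_less_a: "b < a"
begin

lemma pos: "0 < a" "0 < b" "c < a"
  using c_pos c_less_b b_less_a by linarith+

text \<open>
  The quadratic form of the ellipse at the point of the unit circle with angle \<open>t\<close>; up to a factor
  it is the square of the integrand's denominator in the elliptic integral.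
\<close>

definition tangent_power :: "real \<Rightarrow> real"
  where "tangent_power t = a * (cos t)\<^sup>2 + b * (sin t)\<^sup>2 - c"

lemma tangent_power_altdef: "tangent_power t = (a - c) - (a - b) * (sin t)\<^sup>2"
  unfolding tangent_power_def cos_squared_eq by (simp add: algebra_simps)

lemma tangent_power_pos: "0 < tangent_power t"
proof -
  have "(a - b) * (sin t)\<^sup>2 \<le> (a - b) * 1"
    using b_less_a by (intro mult_left_mono) (auto simp: abs_square_le_1)
  then show ?thesis
    using c_less_b by (simp add: tangent_power_altdef)
qed

text \<open>
  The associated bilinear form at two points of the circle.
\<close>

definition polar_form :: "real \<Rightarrow> real \<Rightarrow> real"
  where "polar_form s t = a * (cos s * cos t) + b * (sin s * sin t) - c"

text \<open>
  The chord between the angles \<open>m - d\<close> and \<open>m + d\<close> lies on the line \<open>x cos m + y sin m = cos d\<close>, and the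
  right-hand side of the equation is the square of the support function of the ellipse in the
  direction \<open>m\<close>.
\<close>

definition tangent_chord :: "real \<Rightarrow> real \<Rightarrow> bool"
  where "tangent_chord m d \<longleftrightarrow> 0 < d \<and> d < pi / 2 \<and> (cos d)\<^sup>2 = c * ((cos m)\<^sup>2 / a + (sin m)\<^sup>2 / b)"

text \<open>
  For a tangent line the quadratic form restricted to the chord has a double zero, so its
  discriminant vanishes: the square of the polar form equals the product of the two powers. The
  sign is negative because the zero lies between the end points.
\<close>

lemma tangent_chord_polar_form:
  assumes "tangent_chord m d"
  shows "polar_form (m - d) (m + d) = - sqrt (tangent_power (m - d) * tangent_power (m + d))"
proof -
  have cos_d: "a * b * (cos d)\<^sup>2 = c * (b * (cos m)\<^sup>2 + a * (sin m)\<^sup>2)"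
    using assms pos by (simp add: tangent_chord_def field_simps)
  \<comment> \<open>Lagrange's identity for the form with the diagonal \<open>(a, b, -c)\<close>.\<close>
  have "tangent_power (m - d) * tangent_power (m + d) - (polar_form (m - d) (m + d))\<^sup>2
      = a * b * (cos (m - d) * sin (m + d) - cos (m + d) * sin (m - d))\<^sup>2
        - b * c * (sin (m + d) - sin (m - d))\<^sup>2 - a * c * (cos (m + d) - cos (m - d))\<^sup>2"
    unfolding tangent_power_def polar_form_def by algebra
  also have "cos (m - d) * sin (m + d) - cos (m + d) * sin (m - d) = 2 * sin d * cos d"
    using sin_diff[of "m + d" "m - d"] sin_double[of d] by (simp add: algebra_simps)
  also have "sin (m + d) - sin (m - d) = 2 * sin d * cos m"
    by (simp add: sin_add sin_diff)
  also have "cos (m + d) - cos (m - d) = - 2 * sin d * sin m"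
    by (simp add: cos_add cos_diff)
  also have "a * b * (2 * sin d * cos d)\<^sup>2 - b * c * (2 * sin d * cos m)\<^sup>2 - a * c * (- 2 * sin d * sin m)\<^sup>2
      = 4 * (sin d)\<^sup>2 * (a * b * (cos d)\<^sup>2 - c * (b * (cos m)\<^sup>2 + a * (sin m)\<^sup>2))"
    by (simp add: power2_eq_square algebra_simps)
  finally have sq: "(polar_form (m - d) (m + d))\<^sup>2 = tangent_power (m - d) * tangent_power (m + d)"
    using cos_d by simp
  have "polar_form (m - d) (m + d) = (a + b) * (cos d)\<^sup>2 - a * (sin m)\<^sup>2 - b * (cos m)\<^sup>2 - c"
    unfolding polar_form_def cos_diff cos_add sin_diff sin_add
    using sin_cos_squared_add[of m] sin_cos_squared_add[of d] by algebra
  also have "\<dots> = - ((sin m)\<^sup>2 * (a * (b - c) / b)) - (cos m)\<^sup>2 * (b * (a - c) / a)"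
  proof -
    have "(a + b) * (c * (C / a + S / b)) = c * C + c * S + b * c / a * C + a * c / b * S" for C S
      using pos by (simp add: field_simps)
    moreover have "(cos d)\<^sup>2 = c * ((cos m)\<^sup>2 / a + (sin m)\<^sup>2 / b)"
      using assms by (simp add: tangent_chord_def)
    ultimately have "(a + b) * (cos d)\<^sup>2 = c * (cos m)\<^sup>2 + c * (sin m)\<^sup>2 + b * c / a * (cos m)\<^sup>2 + a * c / b * (sin m)\<^sup>2"
      by simp
    moreover have "c * (cos m)\<^sup>2 + c * (sin m)\<^sup>2 = c"
      by (simp flip: distrib_left)
    ultimately show ?thesis
      using pos by (simp add: field_simps)
  qed
  also have "\<dots> \<le> 0"
  proof -
    have "0 \<le> (sin m)\<^sup>2 * (a * (b - c) / b)" "0 \<le> (cos m)\<^sup>2 * (b * (a - c) / a)"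
      using pos c_less_b by (auto intro!: mult_nonneg_nonneg divide_nonneg_nonneg)
    then show ?thesis
      by linarith
  qed
  finally have "polar_form (m - d) (m + d) \<le> 0" .
  moreover have "\<bar>polar_form (m - d) (m + d)\<bar> = sqrt (tangent_power (m - d) * tangent_power (m + d))"
    by (simp flip: sq)
  ultimately show ?thesis
    by simp
qed

text \<open>
  By the preceding lemma the square of the left-hand side is the value of the form
  \<open>a x\<^sup>2 + b y\<^sup>2\<close> on the chord as a vector.
\<close>

lemma tangent_chord_sqrt_power_sum:
  assumes "tangent_chord m d"
  shows "sqrt (tangent_power (m - d)) + sqrt (tangent_power (m + d)) = sqrt (a * b / c) * sin (2 * d)"
proof -
  have d: "0 < sin d" "0 < cos d" and cos_d: "a * b * (cos d)\<^sup>2 / c = b * (cos m)\<^sup>2 + a * (sin m)\<^sup>2"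
    using assms pos c_pos sin_gt_zero[of d] cos_gt_zero[of d] by (auto simp: tangent_chord_def field_simps)
  have "(sqrt (tangent_power (m - d)) + sqrt (tangent_power (m + d)))\<^sup>2
      = tangent_power (m - d) + tangent_power (m + d) + 2 * sqrt (tangent_power (m - d) * tangent_power (m + d))"
    using tangent_power_pos[of "m - d"] tangent_power_pos[of "m + d"]
    by (simp add: power2_sum real_sqrt_mult)
  also have "\<dots> = tangent_power (m - d) + tangent_power (m + d) - 2 * polar_form (m - d) (m + d)"
    by (simp add: tangent_chord_polar_form[OF assms])
  also have "\<dots> = a * (cos (m + d) - cos (m - d))\<^sup>2 + b * (sin (m + d) - sin (m - d))\<^sup>2"
    unfolding tangent_power_def polar_form_def by algebra
  also have "\<dots> = 4 * (sin d)\<^sup>2 * (b * (cos m)\<^sup>2 + a * (sin m)\<^sup>2)"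
    by (simp add: cos_add cos_diff sin_add sin_diff power2_eq_square algebra_simps)
  also have "\<dots> = (sqrt (a * b / c) * sin (2 * d))\<^sup>2"
    using pos c_pos by (simp add: sin_double power_mult_distrib flip: cos_d)
  finally show ?thesis
    using d pos c_pos tangent_power_pos[of "m - d"] tangent_power_pos[of "m + d"]
    by (subst (asm) power2_eq_iff_nonneg) (auto simp: sin_double)
qed

definition half_angle :: "real \<Rightarrow> real"
  where "half_angle m = arccos (sqrt (c * ((cos m)\<^sup>2 / a + (sin m)\<^sup>2 / b)))"

lemma support_bounds:
  shows "0 < c * ((cos m)\<^sup>2 / a + (sin m)\<^sup>2 / b)" and "c * ((cos m)\<^sup>2 / a + (sin m)\<^sup>2 / b) < 1"
proof -
  define k where "k = c / b - c / a"
  have eq: "c * ((cos m)\<^sup>2 / a + (sin m)\<^sup>2 / b) = c / a + k * (sin m)\<^sup>2"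
    unfolding cos_squared_eq k_def by (simp add: algebra_simps diff_divide_distrib)
  have k: "0 \<le> k"
    using pos c_pos b_less_a by (auto simp: k_def intro!: divide_left_mono)
  then have "k * (sin m)\<^sup>2 \<le> k * 1"
    by (intro mult_left_mono) (auto simp: abs_square_le_1)
  also have "\<dots> < 1 - c / a"
    using pos c_less_b by (simp add: k_def)
  finally have "k * (sin m)\<^sup>2 < 1 - c / a" .
  moreover have "0 \<le> k * (sin m)\<^sup>2" "0 < c / a"
    using k pos c_pos by simp_all
  ultimately show "0 < c * ((cos m)\<^sup>2 / a + (sin m)\<^sup>2 / b)" "c * ((cos m)\<^sup>2 / a + (sin m)\<^sup>2 / b) < 1"
    unfolding eq by linarith+
qed

lemma tangent_chord_half_angle: "tangent_chord m (half_angle m)"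
proof -
  define s where "s = sqrt (c * ((cos m)\<^sup>2 / a + (sin m)\<^sup>2 / b))"
  have s: "0 < s" "s < 1" "s\<^sup>2 = c * ((cos m)\<^sup>2 / a + (sin m)\<^sup>2 / b)"
    using support_bounds[of m] by (simp_all add: s_def)
  have "arccos s < pi / 2" "0 < arccos s"
    using s arccos_less_arccos[of 0 s] arccos_less_arccos[of s 1] by simp_all
  moreover have "cos (arccos s) = s"
    using s by (intro cos_arccos) auto
  ultimately show ?thesis
    using s(3) by (simp add: tangent_chord_def half_angle_def flip: s_def)
qed

text \<open>
  Differentiating \<open>cos\<^sup>2 d = c (cos\<^sup>2 m / a + sin\<^sup>2 m / b)\<close> gives a quotient of \<open>sin (2 m)\<close> by \<open>sin (2 d)\<close>.
  The numerator of the claimed form becomes \<open>R\<^sub>2\<^sup>2 - R\<^sub>1\<^sup>2\<close> after multiplication with \<open>R\<^sub>1 + R\<^sub>2\<close>, a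
  multiple of \<open>sin (2 m) sin (2 d)\<close>, and the denominator is a multiple of \<open>sin (2 d)\<close>. This form is
  the infinitesimal version of the Poncelet map preserving \<open>dt / R(t)\<close>.
\<close>

lemma half_angle_has_derivative:
  defines "R\<^sub>1 \<equiv> \<lambda>m. sqrt (tangent_power (m - half_angle m))" and "R\<^sub>2 \<equiv> \<lambda>m. sqrt (tangent_power (m + half_angle m))"
  shows "(half_angle has_real_derivative (R\<^sub>2 m - R\<^sub>1 m) / (R\<^sub>1 m + R\<^sub>2 m)) (at m)"
proof -
  define d where "d = half_angle m"
  define D where "D = - (c * (a - b) / (a * b) * sin (2 * m)) / sin (2 * d)"
  have tc: "tangent_chord m d"
    using tangent_chord_half_angle by (simp add: d_def)
  have sin_2d: "0 < sin (2 * d)"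
    using tc by (intro sin_gt_zero) (auto simp: tangent_chord_def)
  have "half_angle = (\<lambda>m. arccos (sqrt (c * ((cos m)\<^sup>2 / a + (sin m)\<^sup>2 / b))))"
    by (simp add: half_angle_def fun_eq_iff)
  moreover have "((\<lambda>m. arccos (sqrt (c * ((cos m)\<^sup>2 / a + (sin m)\<^sup>2 / b)))) has_real_derivative D) (at m)"
  proof -
    define u where "u = c * ((cos m)\<^sup>2 / a + (sin m)\<^sup>2 / b)"
    have u: "0 < u" "u < 1"
      using support_bounds[of m] by (simp_all add: u_def)
    have cosd: "cos d = sqrt u"
      using u unfolding d_def half_angle_def u_def[symmetric] by (intro cos_arccos) (auto intro: order_trans[of _ 0])
    have sind: "sin d = sqrt (1 - u)"
      using u by (simp add: d_def half_angle_def sin_arccos_abs flip: u_def)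
    have "- 1 < sqrt u"
      using u(1) real_sqrt_gt_zero[of u] by linarith
    then have "((\<lambda>m. arccos (sqrt (c * ((cos m)\<^sup>2 / a + (sin m)\<^sup>2 / b)))) has_real_derivative
      inverse (- sqrt (1 - (sqrt u)\<^sup>2)) * (inverse (sqrt u) / 2 * (c * (2 * cos m * - sin m / a + 2 * sin m * cos m / b)))) (at m)"
      using u pos unfolding u_def
      by (auto intro!: derivative_eq_intros simp: mult_ac)
    also have "inverse (- sqrt (1 - (sqrt u)\<^sup>2)) * (inverse (sqrt u) / 2 * (c * (2 * cos m * - sin m / a + 2 * sin m * cos m / b))) = D"
      using u pos c_pos by (simp add: D_def sin_double cosd sind) (simp add: field_simps)
    finally show ?thesis .
  qed
  moreover have "D = (R\<^sub>2 m - R\<^sub>1 m) / (R\<^sub>1 m + R\<^sub>2 m)"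
  proof -
    have R: "0 < R\<^sub>1 m" "0 < R\<^sub>2 m"
      using tangent_power_pos by (simp_all add: R\<^sub>1_def R\<^sub>2_def)
    have sum: "R\<^sub>1 m + R\<^sub>2 m = sqrt (a * b / c) * sin (2 * d)"
      using tangent_chord_sqrt_power_sum[OF tc] by (simp add: R\<^sub>1_def R\<^sub>2_def d_def)
    have "(R\<^sub>2 m - R\<^sub>1 m) * (R\<^sub>1 m + R\<^sub>2 m) = (R\<^sub>2 m)\<^sup>2 - (R\<^sub>1 m)\<^sup>2"
      by (simp add: power2_eq_square algebra_simps)
    also have "\<dots> = tangent_power (m + d) - tangent_power (m - d)"
      using tangent_power_pos[of "m + d"] tangent_power_pos[of "m - d"] by (simp add: R\<^sub>1_def R\<^sub>2_def d_def)
    also have "\<dots> = - (a - b) * ((sin (m + d))\<^sup>2 - (sin (m - d))\<^sup>2)"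
      by (simp add: tangent_power_altdef algebra_simps)
    also have "(sin (m + d))\<^sup>2 - (sin (m - d))\<^sup>2 = sin (2 * m) * sin (2 * d)"
      unfolding sin_add sin_diff sin_double by (simp add: power2_eq_square algebra_simps)
    finally have "(R\<^sub>2 m - R\<^sub>1 m) / (R\<^sub>1 m + R\<^sub>2 m) = - (a - b) * (sin (2 * m) * sin (2 * d)) / (R\<^sub>1 m + R\<^sub>2 m)\<^sup>2"
      using R by (simp add: power2_eq_square divide_eq_eq eq_divide_eq)
    also have "(R\<^sub>1 m + R\<^sub>2 m)\<^sup>2 = a * b / c * (sin (2 * d))\<^sup>2"
      using pos c_pos by (simp add: sum power_mult_distrib)
    also have "- (a - b) * (sin (2 * m) * sin (2 * d)) / (a * b / c * (sin (2 * d))\<^sup>2) = D"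
      using sin_2d pos c_pos by (simp add: D_def power2_eq_square field_simps)
    finally show ?thesis ..
  qed
  ultimately show ?thesis
    by simp
qed

text \<open>
  Every point of the circle is the initial point of a tangent chord, since \<open>m - half_angle m\<close> differs
  from \<open>m\<close> by less than \<open>\<pi>/2\<close>.
\<close>

lemma ex_tangent_chord_from: "\<exists>m. m - half_angle m = s"
proof -
  have "continuous_on UNIV (\<lambda>m. m - half_angle m)"
    using half_angle_has_derivative
    by (intro continuous_on_diff continuous_on_id) (meson DERIV_continuous continuous_at_imp_continuous_on)
  moreover have "s - half_angle s \<le> s" "s \<le> (s + pi / 2) - half_angle (s + pi / 2)"
    using tangent_chord_half_angle[of s] tangent_chord_half_angle[of "s + pi / 2"]
    by (auto simp: tangent_chord_def)
  ultimately show ?thesis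
    using IVT'[of "\<lambda>m. m - half_angle m" s s "s + pi / 2"] continuous_on_subset pi_ge_zero
    by (smt (verit) top_greatest pi_half_ge_zero)
qed

text \<open>
  The difference of the values of \<open>F\<close> at the ends of a tangent chord has derivative zero in \<open>m\<close>. Its
  value is found at the chord \<open>m = 0\<close>, which is symmetric about the \<open>x\<close>-axis.
\<close>

lemma elliptic_F_tangent_chord:
  defines "e \<equiv> sqrt ((a - b) / (a - c))"
  shows "elliptic_F (m + half_angle m) e = elliptic_F (m - half_angle m) e + 2 * elliptic_F (arcsin (sqrt ((a - c) / a))) e"
proof -
  have e2: "e\<^sup>2 = (a - b) / (a - c)"
    using b_less_a pos by (simp add: e_def)
  have e1: "e\<^sup>2 < 1"
    using c_less_b pos by (simp add: e2 field_simps)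
  have integrand: "1 / sqrt (1 - e\<^sup>2 * (sin t)\<^sup>2) = sqrt (a - c) / sqrt (tangent_power t)" for t
  proof -
    have "1 - e\<^sup>2 * (sin t)\<^sup>2 = tangent_power t / (a - c)"
      using pos by (simp add: e2 tangent_power_altdef field_simps)
    then show ?thesis
      by (simp add: real_sqrt_divide)
  qed
  let ?J = "\<lambda>m. elliptic_F (m + half_angle m) e - elliptic_F (m - half_angle m) e"
  have "(?J has_real_derivative 0) (at m)" for m
  proof -
    let ?R\<^sub>1 = "sqrt (tangent_power (m - half_angle m))" and ?R\<^sub>2 = "sqrt (tangent_power (m + half_angle m))"
    let ?D = "(?R\<^sub>2 - ?R\<^sub>1) / (?R\<^sub>1 + ?R\<^sub>2)"
    have R: "0 < ?R\<^sub>1" "0 < ?R\<^sub>2"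
      using tangent_power_pos by simp_all
    then have sum: "?R\<^sub>1 + ?R\<^sub>2 \<noteq> 0"
      by linarith
    have "(?J has_real_derivative
        sqrt (a - c) / ?R\<^sub>2 * (1 + ?D) - sqrt (a - c) / ?R\<^sub>1 * (1 - ?D)) (at m)"
      unfolding integrand[symmetric]
      by (intro DERIV_diff DERIV_chain2[OF elliptic_F_has_derivative[OF e1]] DERIV_add DERIV_ident
          half_angle_has_derivative)
    moreover have "1 + ?D = 2 * ?R\<^sub>2 / (?R\<^sub>1 + ?R\<^sub>2)" "1 - ?D = 2 * ?R\<^sub>1 / (?R\<^sub>1 + ?R\<^sub>2)"
      using sum by (simp_all add: field_simps del: real_sqrt_eq_0_iff real_sqrt_gt_0_iff)
    ultimately show ?thesis
      using R by simp
  qed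
  then have "?J m = ?J 0"
    by (intro DERIV_isconst_all) blast
  moreover have "half_angle 0 = arcsin (sqrt ((a - c) / a))"
  proof -
    have "half_angle 0 = arccos (sqrt (c / a))"
      by (simp add: half_angle_def)
    also have "\<dots> = arcsin (sqrt (1 - (sqrt (c / a))\<^sup>2))"
      using pos c_pos by (intro arccos_arcsin_sqrt_pos) auto
    also have "1 - (sqrt (c / a))\<^sup>2 = (a - c) / a"
      using pos c_pos by (simp add: field_simps)
    finally show ?thesis .
  qed
  ultimately show ?thesis
    using elliptic_F_minus[OF e1, of "half_angle 0"] by simp
qed

end

section \<open>Homogeneous coordinates\<close>

text \<open>Here \<open>$\<close> only denotes components of vectors; coefficients of power series do not occur.\<close>

no_notation fps_nth (infixl "$" 75)

lemma homog_simps [simp]: "homog z $ 1 = Re z" "homog z $ 2 = Im z" "homog z $ 3 = 1"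
  by (simp_all add: homog_def)

lemma symmetric_form_commute:
  fixes A :: "real ^ 'n ^ 'n"
  assumes "transpose A = A"
  shows "u \<bullet> (A *v w) = w \<bullet> (A *v u)"
  by (metis assms dot_lmul_matrix inner_commute transpose_matrix_vector)

text \<open>
  The orientation of three homogeneous vectors; for points of the affine plane it is the planar
  cross product in the definition of \<open>on_left\<close>.
\<close>

definition triple :: "real ^ 3 \<Rightarrow> real ^ 3 \<Rightarrow> real ^ 3 \<Rightarrow> real"
  where "triple u v w = det (vector [u, v, w])"

lemma triple_altdef:
  "triple u v w = u $ 1 * v $ 2 * w $ 3 + u $ 2 * v $ 3 * w $ 1 + u $ 3 * v $ 1 * w $ 2
    - u $ 1 * v $ 3 * w $ 2 - u $ 2 * v $ 1 * w $ 3 - u $ 3 * v $ 2 * w $ 1"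
  unfolding triple_def det_3 vector_3 ..

lemma triple_scaleR [simp]: "triple (r *\<^sub>R u) (s *\<^sub>R v) (t *\<^sub>R w) = r * s * t * triple u v w"
  by (simp add: triple_altdef algebra_simps)

lemma cross_eq_triple: "Im (cnj (w - z) * (p - z)) = triple (homog z) (homog w) (homog p)"
  by (simp add: triple_altdef algebra_simps)

definition proj :: "real ^ 3 \<Rightarrow> complex"
  where "proj u = Complex (u $ 1 / u $ 3) (u $ 2 / u $ 3)"

lemma homog_proj: "u $ 3 \<noteq> 0 \<Longrightarrow> homog (proj u) = (1 / u $ 3) *\<^sub>R u"
  by (simp add: vec_eq_iff forall_3 proj_def)

lemma proj_homog [simp]: "proj (homog z) = z"
  by (simp add: proj_def)

lemma proj_scaleR: "r \<noteq> 0 \<Longrightarrow> proj (r *\<^sub>R u) = proj u"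
  by (simp add: proj_def)

text \<open>
  Positive combinations of homogeneous vectors in the half-space of positive third component project
  into the segment, although the weights change.
\<close>

lemma proj_in_segment:
  assumes "u $ 3 > 0" "v $ 3 > 0" "r > 0" "s > 0"
  shows "proj (r *\<^sub>R u + s *\<^sub>R v) \<in> closed_segment (proj u) (proj v)"
proof -
  define k where "k = s * v $ 3 / (r * u $ 3 + s * v $ 3)"
  have pos: "0 < r * u $ 3" "0 < s * v $ 3"
    using assms by simp_all
  then have "0 \<le> k" "k \<le> 1"
    by (auto simp: k_def)
  moreover have "proj (r *\<^sub>R u + s *\<^sub>R v) = (1 - k) *\<^sub>R proj u + k *\<^sub>R proj v"
  proof -
    have k': "1 - k = r * u $ 3 / (r * u $ 3 + s * v $ 3)"
      using pos by (simp add: k_def field_simps)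
    have "r * x * U * V = r * U * V * x" for x U V :: real
      by simp
    then show ?thesis
      unfolding k' unfolding k_def using assms
      by (simp add: complex_eq_iff proj_def add_divide_distrib)
  qed
  ultimately show ?thesis
    by (auto simp: in_segment)
qed

section \<open>The Poncelet map of a conic pair with a common self-polar triangle\<close>

text \<open>
  The vectors \<open>v1\<close>, \<open>v2\<close>, \<open>v3\<close> are orthogonal for both forms and normalized so that \<open>A\<close> becomes the unit
  circle. The last three assumptions connect the coordinates with the affine plane: the line at
  infinity misses the disc, \<open>v3\<close> is an affine point with positive weight, and the frame preserves
  orientation.
\<close>

locale self_polar_frame = inner_ellipse a b c for a b c :: real +
  fixes A C :: "real ^ 3 ^ 3" and v1 v2 v3 :: "real ^ 3"
  assumes symmetric: "transpose A = A" "transpose C = C"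
    and A_diag: "v1 \<bullet> (A *v v1) = 1" "v2 \<bullet> (A *v v2) = 1" "v3 \<bullet> (A *v v3) = - 1"
    and A_orth: "v1 \<bullet> (A *v v2) = 0" "v1 \<bullet> (A *v v3) = 0" "v2 \<bullet> (A *v v3) = 0"
    and C_diag: "v1 \<bullet> (C *v v1) = a" "v2 \<bullet> (C *v v2) = b" "v3 \<bullet> (C *v v3) = - c"
    and C_orth: "v1 \<bullet> (C *v v2) = 0" "v1 \<bullet> (C *v v3) = 0" "v2 \<bullet> (C *v v3) = 0"
    and A_pos_at_infinity: "\<And>u. u \<noteq> 0 \<Longrightarrow> u $ 3 = 0 \<Longrightarrow> u \<bullet> (A *v u) > 0"
    and v3_pos: "v3 $ 3 > 0"
    and frame_positive: "triple v1 v2 v3 > 0"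
begin

definition emb :: "real \<Rightarrow> real \<Rightarrow> real \<Rightarrow> real ^ 3"
  where "emb x y w = x *\<^sub>R v1 + y *\<^sub>R v2 + w *\<^sub>R v3"

lemma A_emb: "emb x y w \<bullet> (A *v emb x' y' w') = x * x' + y * y' - w * w'"
  using symmetric_form_commute[OF symmetric(1)] A_diag A_orth
  by (simp add: emb_def matrix_vector_right_distrib matrix_vector_mult_scaleR inner_add)

lemma C_emb: "emb x y w \<bullet> (C *v emb x' y' w') = a * (x * x') + b * (y * y') - c * (w * w')"
  using symmetric_form_commute[OF symmetric(2)] C_diag C_orth
  by (simp add: emb_def matrix_vector_right_distrib matrix_vector_mult_scaleR inner_add)

lemma triple_emb:
  "triple (emb x y w) (emb x' y' w') (emb x'' y'' w'')
    = triple v1 v2 v3 * triple (vector [x, y, w]) (vector [x', y', w']) (vector [x'', y'', w''])"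
  by (simp add: emb_def triple_altdef) algebra

lemma emb_surj: obtains x y w where "u = emb x y w"
proof -
  define M :: "real ^ 3 ^ 3" where "M = transpose (vector [v1, v2, v3])"
  have "det M \<noteq> 0"
    using frame_positive by (simp add: M_def det_transpose triple_def)
  then obtain M' where "M ** M' = mat 1"
    using invertible_det_nz by (auto simp: invertible_def)
  then have "M *v (M' *v u) = u"
    by (simp add: matrix_vector_mul_assoc)
  moreover have "M *v x = emb (x $ 1) (x $ 2) (x $ 3)" for x
    by (simp add: M_def emb_def vec_eq_iff forall_3 matrix_vector_mult_def sum_3 transpose_def)
  ultimately show ?thesis
    using that by metis
qed

lemma emb_inj: "emb x y w = emb x' y' w' \<longleftrightarrow> x = x' \<and> y = y' \<and> w = w'"
proof
  assume eq: "emb x y w = emb x' y' w'"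
  show "x = x' \<and> y = y' \<and> w = w'"
    using A_emb[of 1 0 0 x y w] A_emb[of 0 1 0 x y w] A_emb[of 0 0 1 x y w]
    unfolding eq A_emb by simp
qed auto

lemma emb_0: "emb 0 0 0 = 0"
  by (simp add: emb_def)

text \<open>
  The cone over the closed disc does not meet the plane at infinity. A vector of the cone with
  nonpositive third component could be combined with \<open>v3\<close> to a nonzero vector at infinity on which \<open>A\<close>
  is not positive.
\<close>

lemma emb_pos:
  assumes "x\<^sup>2 + y\<^sup>2 \<le> w\<^sup>2" and "w > 0"
  shows "emb x y w $ 3 > 0"
proof (rule ccontr)
  define r where "r = v3 $ 3"
  define h where "h = emb x y w $ 3"
  assume "\<not> emb x y w $ 3 > 0"
  then have h: "h \<le> 0"
    by (simp add: h_def)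
  have r: "r > 0"
    using v3_pos by (simp add: r_def)
  define u where "u = emb (r * x) (r * y) (r * w - h)"
  have "u = r *\<^sub>R emb x y w - h *\<^sub>R v3"
    by (simp add: u_def emb_def algebra_simps)
  then have "u $ 3 = 0"
    by (simp add: r_def h_def)
  moreover have rw: "0 < r * w"
    using r assms by simp
  then have "u \<noteq> 0"
    using h emb_inj[of _ _ _ 0 0 0] by (auto simp: u_def emb_0)
  ultimately have "0 < (r * x)\<^sup>2 + (r * y)\<^sup>2 - (r * w - h)\<^sup>2"
    using A_pos_at_infinity[of u] by (simp add: u_def A_emb power2_eq_square)
  also have "(r * x)\<^sup>2 + (r * y)\<^sup>2 = r\<^sup>2 * (x\<^sup>2 + y\<^sup>2)"
    by (simp add: algebra_simps power_mult_distrib)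
  also have "\<dots> \<le> r\<^sup>2 * w\<^sup>2"
    using assms by (intro mult_left_mono) auto
  also have "\<dots> = (r * w)\<^sup>2"
    by (simp add: power_mult_distrib)
  also have "\<dots> \<le> (r * w - h)\<^sup>2"
    using h rw by (intro power_mono) auto
  finally show False
    by simp
qed

lemma emb_eq_homog_pos:
  assumes "homog z = emb x y w" and "x\<^sup>2 + y\<^sup>2 \<le> w\<^sup>2"
  shows "w > 0"
proof -
  have "w \<noteq> 0"
  proof
    assume "w = 0"
    then have "x = 0" "y = 0"
      using assms(2) sum_power2_le_zero_iff[of x y] by auto
    then have "homog z $ 3 = 0"
      using assms(1) \<open>w = 0\<close> by (simp add: emb_0)
    then show False
      by simp
  qed
  moreover have "\<not> w < 0"
  proof
    assume "w < 0"
    then have "emb (- x) (- y) (- w) $ 3 > 0"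
      using assms(2) by (intro emb_pos) auto
    moreover have "emb (- x) (- y) (- w) = - homog z"
      by (simp add: assms(1) emb_def)
    ultimately show False
      by simp
  qed
  ultimately show ?thesis
    by simp
qed

text \<open>
  The circle parametrized by its angle in the coordinates of the frame. In the affine plane this is
  not the usual angle of the ellipse, as the coordinate change is only projective.
\<close>

definition arc_vec :: "real \<Rightarrow> real ^ 3"
  where "arc_vec t = emb (cos t) (sin t) 1"

definition arc_pt :: "real \<Rightarrow> complex"
  where "arc_pt t = proj (arc_vec t)"

lemma arc_vec_pos: "arc_vec t $ 3 > 0"
  unfolding arc_vec_def by (intro emb_pos) auto

lemma homog_arc_pt: "homog (arc_pt t) = (1 / arc_vec t $ 3) *\<^sub>R arc_vec t"
  using arc_vec_pos[of t] by (simp add: arc_pt_def homog_proj)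

lemma arc_pt_in_conic: "arc_pt t \<in> conic_curve A"
  by (simp add: conic_curve_def homog_arc_pt matrix_vector_mult_scaleR)
    (simp add: arc_vec_def A_emb flip: power2_eq_square)

lemma proj_v3_notin_conic: "proj v3 \<notin> conic_curve A"
  using v3_pos by (simp add: conic_curve_def homog_proj matrix_vector_mult_scaleR A_diag)

lemma range_arc_pt: "range arc_pt = conic_curve A"
proof
  show "range arc_pt \<subseteq> conic_curve A"
    using arc_pt_in_conic by auto
  show "conic_curve A \<subseteq> range arc_pt"
  proof
    fix z assume z: "z \<in> conic_curve A"
    obtain x y w where xyw: "homog z = emb x y w"
      by (rule emb_surj)
    have eq: "x\<^sup>2 + y\<^sup>2 = w\<^sup>2"
      using z by (simp add: conic_curve_def xyw A_emb power2_eq_square)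
    then have w: "w > 0"
      using emb_eq_homog_pos[OF xyw] by simp
    have "(x / w)\<^sup>2 + (y / w)\<^sup>2 = 1"
      using eq w by (simp add: power_divide flip: add_divide_distrib)
    then obtain t where t: "x / w = cos t" "y / w = sin t"
      using sincos_total_2pi by metis
    have "arc_pt t = proj (w *\<^sub>R arc_vec t)"
      using w by (simp add: arc_pt_def proj_scaleR)
    also have "w *\<^sub>R arc_vec t = homog z"
      using w by (simp add: arc_vec_def emb_def xyw algebra_simps flip: t)
    finally show "z \<in> range arc_pt"
      by auto
  qed
qed

lemma arc_pt_eq_iff: "arc_pt s = arc_pt t \<longleftrightarrow> (\<exists>n::int. s = t + 2 * pi * n)"
proof
  assume "arc_pt s = arc_pt t"
  then have "(1 / arc_vec s $ 3) *\<^sub>R arc_vec s = (1 / arc_vec t $ 3) *\<^sub>R arc_vec t"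
    by (metis homog_arc_pt)
  moreover have "k *\<^sub>R arc_vec r = emb (k * cos r) (k * sin r) k" for k r
    by (simp add: arc_vec_def emb_def algebra_simps)
  ultimately have "cos s = cos t" "sin s = sin t"
    using arc_vec_pos[of s] arc_vec_pos[of t] by (auto simp: emb_inj)
  then show "\<exists>n::int. s = t + 2 * pi * n"
    using sin_cos_eq_iff by blast
next
  assume "\<exists>n::int. s = t + 2 * pi * n"
  then have "sin s = sin t \<and> cos s = cos t"
    using sin_cos_eq_iff by blast
  then show "arc_pt s = arc_pt t"
    by (simp add: arc_pt_def arc_vec_def)
qed

text \<open>
  The velocity of a projected curve \<open>n\<close>, crossed with its position relative to the projection of \<open>w\<close>,
  only involves the determinant of \<open>n\<close>, \<open>n'\<close> and \<open>w\<close>, because the derivative of the weight contributes a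
  multiple of \<open>n\<close>.
\<close>

lemma cross_tangent_vector:
  fixes n1 n2 n3 n1' n2' n3' w1 w2 w3 k :: real
  assumes "n3 \<noteq> 0" "w3 \<noteq> 0"
  shows "Im (Complex (k * (n1' * n3 - n1 * n3') / n3\<^sup>2) (k * (n2' * n3 - n2 * n3') / n3\<^sup>2)
      * cnj (Complex (n1 / n3) (n2 / n3) - Complex (w1 / w3) (w2 / w3)))
    = k * triple (vector [n1, n2, n3]) (vector [n1', n2', n3']) (vector [w1, w2, w3]) / (w3 * n3\<^sup>2)"
  using assms by (simp add: triple_altdef field_simps power2_eq_square)

text \<open>
  Seen from the centre \<open>v3\<close> the angle always increases, since the determinant of position, velocity
  and \<open>v3\<close> is the constant \<open>triple v1 v2 v3 > 0\<close>. The bound \<open>\<epsilon>\<close> makes this uniform in \<open>t\<close>.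
\<close>

lemma arc_pt_winding_number_pos:
  defines "\<gamma> \<equiv> \<lambda>t. arc_pt (2 * pi * t)"
  shows "0 < Re (winding_number \<gamma> (proj v3))" and "continuous_on UNIV \<gamma>"
proof -
  define n where "n t = arc_vec (2 * pi * t)" for t
  define n' where "n' t = emb (- sin (2 * pi * t)) (cos (2 * pi * t)) 0" for t
  have n_pos: "n t $ 3 > 0" for t
    using arc_vec_pos by (simp add: n_def)
  have n_nz: "n t $ 3 \<noteq> 0" for t
    using n_pos[of t] by simp
  have deriv_n: "((\<lambda>t. n t $ i) has_real_derivative 2 * pi * n' t $ i) (at t)" for t i
    unfolding n_def n'_def arc_vec_def emb_def
    by (auto intro!: derivative_eq_intros simp: algebra_simps)
  have cont_n: "continuous_on S (\<lambda>t. n t $ i)" and cont_n': "continuous_on S (\<lambda>t. n' t $ i)" for S i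
    unfolding n_def n'_def arc_vec_def emb_def by (simp_all) (intro continuous_intros)+
  define D where "D t = Complex (2 * pi * (n' t $ 1 * n t $ 3 - n t $ 1 * n' t $ 3) / (n t $ 3)\<^sup>2)
      (2 * pi * (n' t $ 2 * n t $ 3 - n t $ 2 * n' t $ 3) / (n t $ 3)\<^sup>2)" for t
  have deriv_q: "((\<lambda>t. n t $ i / n t $ 3) has_real_derivative
      2 * pi * (n' t $ i * n t $ 3 - n t $ i * n' t $ 3) / (n t $ 3)\<^sup>2) (at t)" for t i
    using n_nz[of t] DERIV_quotient[OF deriv_n[of i t] deriv_n[of 3 t] n_nz[of t]]
    by (simp add: algebra_simps power2_eq_square)
  have deriv: "(\<gamma> has_vector_derivative D t) (at t)" for t
    unfolding has_vector_derivative_complex_iff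
    using deriv_q[of 1 t] deriv_q[of 2 t] by (simp add: \<gamma>_def arc_pt_def proj_def D_def flip: n_def)
  then show "continuous_on UNIV \<gamma>"
    by (intro continuous_at_imp_continuous_on ballI has_vector_derivative_continuous[OF deriv])
  have "continuous_on {0..1}
      (\<lambda>t. 2 * pi * (n' t $ i * n t $ 3 - n t $ i * n' t $ 3) / (n t $ 3)\<^sup>2)" for i
    by (intro continuous_on_divide continuous_on_mult continuous_on_diff continuous_on_power
        continuous_on_const cont_n cont_n') (simp add: n_nz)
  then have "continuous_on {0..1} D"
    unfolding D_def by (intro continuous_on_Complex)
  then have "valid_path \<gamma>"
    using deriv unfolding valid_path_def
    by (intro C1_differentiable_imp_piecewise) (auto simp: C1_differentiable_on_def)
  moreover have "proj v3 \<notin> path_image \<gamma>"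
    using proj_v3_notin_conic arc_pt_in_conic by (auto simp: path_image_def \<gamma>_def)
  moreover define M where "M = \<bar>v1 $ 3\<bar> + \<bar>v2 $ 3\<bar> + \<bar>v3 $ 3\<bar>"
  have M: "n t $ 3 \<le> M" for t
  proof -
    have "cos u * v1 $ 3 \<le> \<bar>v1 $ 3\<bar>" "sin u * v2 $ 3 \<le> \<bar>v2 $ 3\<bar>" for u
    proof -
      have "\<bar>cos u\<bar> * \<bar>v1 $ 3\<bar> \<le> 1 * \<bar>v1 $ 3\<bar>" "\<bar>sin u\<bar> * \<bar>v2 $ 3\<bar> \<le> 1 * \<bar>v2 $ 3\<bar>"
        by (intro mult_right_mono; simp)+
      then show "cos u * v1 $ 3 \<le> \<bar>v1 $ 3\<bar>" "sin u * v2 $ 3 \<le> \<bar>v2 $ 3\<bar>"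
        by (simp_all flip: abs_mult)
    qed
    then show ?thesis
      unfolding n_def arc_vec_def emb_def M_def by (simp add: add_mono)
  qed
  define \<epsilon> where "\<epsilon> = 2 * pi * triple v1 v2 v3 / (v3 $ 3 * M\<^sup>2)"
  have "0 < M"
    using M[of 0] n_pos[of 0] by linarith
  then have "0 < \<epsilon>"
    using frame_positive v3_pos by (simp add: \<epsilon>_def)
  moreover have "\<epsilon> \<le> Im (vector_derivative \<gamma> (at t) * cnj (\<gamma> t - proj v3))" for t
  proof -
    have "triple (n t) (n' t) v3 = triple v1 v2 v3"
    proof -
      have "triple (n t) (n' t) (emb 0 0 1) = triple v1 v2 v3"
        unfolding n_def n'_def arc_vec_def triple_emb
        by (simp add: triple_altdef flip: power2_eq_square)
      then show ?thesis
        by (simp add: emb_def)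
    qed
    then have "Im (D t * cnj (\<gamma> t - proj v3)) = 2 * pi * triple v1 v2 v3 / (v3 $ 3 * (n t $ 3)\<^sup>2)"
      using cross_tangent_vector[OF n_nz[of t], of "v3 $ 3" "2 * pi" "n' t $ 1" "n t $ 1" "n' t $ 3"
          "n' t $ 2" "n t $ 2" "v3 $ 1" "v3 $ 2"] v3_pos
      by (simp add: D_def \<gamma>_def arc_pt_def proj_def triple_altdef flip: n_def)
    also have "\<epsilon> \<le> \<dots>"
      unfolding \<epsilon>_def using frame_positive v3_pos n_pos[of t] M[of t]
      by (intro divide_left_mono mult_left_mono power_mono mult_pos_pos) auto
    finally show ?thesis
      using vector_derivative_at[OF deriv] by simp
  qed
  ultimately show "0 < Re (winding_number \<gamma> (proj v3))"
    by (intro winding_number_pos_lt[of \<gamma> "proj v3" \<epsilon>]) auto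
qed

text \<open>
  A simple closed path has winding number \<open>1\<close> around all inside points or \<open>-1\<close> around all of them. The
  positive winding number around \<open>v3\<close> shows that this point is inside and excludes the second case.
\<close>

lemma ccw_parametrization_arc_pt:
  "ccw_parametrization (conic_curve A) (\<lambda>t. arc_pt (2 * pi * t))" (is "ccw_parametrization _ ?\<gamma>")
proof -
  have cont: "continuous_on UNIV ?\<gamma>"
    by (rule arc_pt_winding_number_pos)
  have range: "range ?\<gamma> = conic_curve A"
  proof -
    have "range ?\<gamma> = arc_pt ` range (\<lambda>t. 2 * pi * t)"
      by (rule image_image[symmetric])
    also have "range (\<lambda>t. 2 * pi * t) = UNIV"
      by (rule surjI[of _ "\<lambda>t. t / (2 * pi)"]) simp
    finally show ?thesis
      by (simp add: range_arc_pt)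
  qed
  have inj: "?\<gamma> s = ?\<gamma> t \<longleftrightarrow> s - t \<in> \<int>" for s t
  proof -
    have "2 * pi * s = 2 * pi * t + 2 * pi * of_int n \<longleftrightarrow> s - t = of_int n" for n
    proof -
      have "2 * pi * s = 2 * pi * t + 2 * pi * of_int n \<longleftrightarrow> 2 * pi * s = 2 * pi * (t + of_int n)"
        by (simp add: distrib_left)
      also have "\<dots> \<longleftrightarrow> s - t = of_int n"
        by auto
      finally show ?thesis .
    qed
    then show ?thesis
      unfolding arc_pt_eq_iff by (auto elim: Ints_cases)
  qed
  have circle: "circle_parametrization (conic_curve A) ?\<gamma>"
    using cont range inj by (simp add: circle_parametrization_def)
  note loop = circle_parametrization_simple_loop[OF circle]
  have "winding_number ?\<gamma> z = 1" if "z \<in> inside (conic_curve A)" for z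
  proof (rule simple_closed_path_winding_number_inside[OF loop(1)])
    assume "\<And>z. z \<in> inside (path_image ?\<gamma>) \<Longrightarrow> winding_number ?\<gamma> z = 1"
    then show ?thesis
      using that loop(3) by simp
  next
    assume neg: "\<And>z. z \<in> inside (path_image ?\<gamma>) \<Longrightarrow> winding_number ?\<gamma> z = - 1"
    have "winding_number ?\<gamma> (proj v3) \<noteq> 0" "winding_number ?\<gamma> (proj v3) \<noteq> - 1"
      using arc_pt_winding_number_pos(1) by auto
    moreover have "proj v3 \<notin> path_image ?\<gamma>"
      using proj_v3_notin_conic loop(3) by simp
    ultimately show ?thesis
      using neg winding_number_zero_in_outside[OF simple_path_imp_path[OF loop(1)] loop(2)]
        inside_Un_outside by blast
  qed
  then show ?thesis
    using circle by (simp add: ccw_parametrization_altdef)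
qed


lemma conic_C_inside:
  assumes "p \<in> conic_curve C"
  obtains x y w where "homog p = emb x y w" and "a * x\<^sup>2 + b * y\<^sup>2 = c * w\<^sup>2" and "x\<^sup>2 + y\<^sup>2 < w\<^sup>2"
proof -
  obtain x y w where xyw: "homog p = emb x y w"
    by (rule emb_surj)
  have eq: "a * x\<^sup>2 + b * y\<^sup>2 = c * w\<^sup>2"
    using assms by (simp add: conic_curve_def xyw C_emb power2_eq_square)
  have "w \<noteq> 0"
  proof
    assume "w = 0"
    then have "a * x\<^sup>2 + b * y\<^sup>2 = 0"
      using eq by simp
    then have "x = 0 \<and> y = 0"
      using pos by (simp add: add_nonneg_eq_0_iff)
    then have "homog p $ 3 = 0"
      using \<open>w = 0\<close> by (simp add: xyw emb_0)
    then show False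
      by simp
  qed
  have "b * x\<^sup>2 \<le> a * x\<^sup>2"
    using b_less_a by (intro mult_right_mono) auto
  then have "b * (x\<^sup>2 + y\<^sup>2) \<le> c * w\<^sup>2"
    using eq by (simp add: distrib_left)
  also have "\<dots> < b * w\<^sup>2"
    using c_less_b \<open>w \<noteq> 0\<close> by simp
  finally have "x\<^sup>2 + y\<^sup>2 < w\<^sup>2"
    using pos by simp
  then show ?thesis
    using that xyw eq by blast
qed

lemma conics_disjoint: "conic_curve A \<inter> conic_curve C = {}"
proof -
  have False if z: "z \<in> conic_curve A" "z \<in> conic_curve C" for z
  proof -
    obtain x y w where "homog z = emb x y w" "x\<^sup>2 + y\<^sup>2 < w\<^sup>2"
      using conic_C_inside[OF z(2)] by blast
    then show False
      using z(1) by (simp add: conic_curve_def A_emb power2_eq_square)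
  qed
  then show ?thesis
    by blast
qed

text \<open>
  A line meets the ellipse in at most two points: along the line the form is a quadratic polynomial
  with positive leading coefficient.
\<close>

lemma collinear_conic_points_eq:
  assumes "z \<in> conic_curve A" "w \<in> conic_curve A" "w' \<in> conic_curve A"
    and "w \<noteq> z" "w' \<noteq> z" and "Im (cnj (w - z) * (w' - z)) = 0"
  shows "w = w'"
proof -
  define u where "u = homog w - homog z"
  have "(w' - z) / (w - z) \<in> \<real>"
    using assms(4,6) by (simp add: complex_is_Real_iff Im_complex_div_eq_0 algebra_simps)
  then obtain s where s: "(w' - z) / (w - z) = complex_of_real s"
    by (auto elim: Reals_cases)
  then have w': "w' = z + of_real s * (w - z)"
    using assms(4) by (simp add: field_simps)
  then have hom: "homog w' = homog z + s *\<^sub>R u"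
    by (simp add: vec_eq_iff forall_3 u_def)
  have hw: "homog w = homog z + 1 *\<^sub>R u"
    by (simp add: u_def)
  have form: "(homog z + r *\<^sub>R u) \<bullet> (A *v (homog z + r *\<^sub>R u))
      = 2 * r * (homog z \<bullet> (A *v u)) + r\<^sup>2 * (u \<bullet> (A *v u))" for r
    using assms(1) symmetric_form_commute[OF symmetric(1), of u "homog z"]
    by (simp add: conic_curve_def matrix_vector_right_distrib matrix_vector_mult_scaleR inner_add
        power2_eq_square algebra_simps)
  have "u \<noteq> 0"
    using assms(4) by (auto simp: u_def vec_eq_iff forall_3 complex_eq_iff)
  then have "u \<bullet> (A *v u) > 0"
    by (intro A_pos_at_infinity) (auto simp: u_def)
  moreover have "2 * (homog z \<bullet> (A *v u)) + u \<bullet> (A *v u) = 0"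
    using assms(2) form[of 1] unfolding hw[symmetric] by (simp add: conic_curve_def)
  moreover have "2 * s * (homog z \<bullet> (A *v u)) + s\<^sup>2 * (u \<bullet> (A *v u)) = 0"
    using assms(3) form[of s] unfolding hom[symmetric] by (simp add: conic_curve_def)
  ultimately have "s * (s - 1) * (u \<bullet> (A *v u)) = 0" "u \<bullet> (A *v u) \<noteq> 0"
    by (algebra, simp)
  then have "s * (s - 1) = 0"
    by simp
  moreover have "s \<noteq> 0"
    using w' assms(5) by auto
  ultimately show ?thesis
    using w' by simp
qed

text \<open>
  The touching point on the second chord lies to the left of the first chord, and conversely. So
  neither end point is strictly to the right of the other as seen from \<open>z\<close>, and the two are collinear
  with \<open>z\<close>.
\<close>

lemma left_tangent_unique:
  assumes "z \<in> conic_curve A"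
    and w: "w \<in> conic_curve A" "segment_tangent_to z w C" "on_left z w (conic_curve C)"
    and w': "w' \<in> conic_curve A" "segment_tangent_to z w' C" "on_left z w' (conic_curve C)"
  shows "w = w'"
proof -
  have touch: "\<exists>p r. p \<in> conic_curve C \<and> 0 < r \<and> p - z = of_real r * (v - z)"
    if tangent: "segment_tangent_to z v C" for v
  proof -
    obtain p where p: "p \<in> closed_segment z v" "p \<in> conic_curve C"
      using tangent by (auto simp: segment_tangent_to_def)
    then obtain r where r: "0 \<le> r" "p = (1 - r) *\<^sub>R z + r *\<^sub>R v"
      by (auto simp: in_segment)
    have "p \<noteq> z"
      using p(2) assms(1) conics_disjoint by blast
    then have "r \<noteq> 0"
      using r by auto
    moreover have "p - z = of_real r * (v - z)"
      using r by (simp add: scaleR_conv_of_real algebra_simps)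
    ultimately show ?thesis
      using p(2) r(1) by (metis less_eq_real_def)
  qed
  have le: "0 \<le> Im (cnj (v - z) * (v' - z))"
    if left: "on_left z v (conic_curve C)" and tangent: "segment_tangent_to z v' C" for v v'
  proof -
    obtain p r where p: "p \<in> conic_curve C" "0 < r" "p - z = of_real r * (v' - z)"
      using touch[OF tangent] by blast
    then have "0 \<le> Im (cnj (v - z) * (of_real r * (v' - z)))"
      using left unfolding on_left_def by metis
    also have "cnj (v - z) * (of_real r * (v' - z)) = of_real r * (cnj (v - z) * (v' - z))"
      by simp
    also have "Im \<dots> = r * Im (cnj (v - z) * (v' - z))"
      by simp
    finally show ?thesis
      using p(2) by (simp add: zero_le_mult_iff)
  qed
  have "Im (cnj (w - z) * (w' - z)) = - Im (cnj (w' - z) * (w - z))"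
    by (simp add: algebra_simps)
  then have "Im (cnj (w - z) * (w' - z)) = 0"
    using le[OF w(3) w'(2)] le[OF w'(3) w(2)] by linarith
  then show ?thesis
    using assms by (intro collinear_conic_points_eq[of z]) (auto simp: segment_tangent_to_def)
qed

text \<open>
  The polar form of the end points \<open>u\<close>, \<open>v\<close> is \<open>- (r * s)\<close>, where \<open>r\<^sup>2\<close> and \<open>s\<^sup>2\<close> are their powers. Hence
  \<open>s u + r v\<close> is conjugate to both \<open>u\<close> and \<open>v\<close>, and therefore to itself: it is the point of contact.
\<close>

lemma tangent_chord_touches:
  assumes "tangent_chord m d"
  shows "segment_tangent_to (arc_pt (m - d)) (arc_pt (m + d)) C"
proof -
  define u where "u = arc_vec (m - d)"
  define v where "v = arc_vec (m + d)"
  define r where "r = sqrt (tangent_power (m - d))"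
  define s where "s = sqrt (tangent_power (m + d))"
  have r: "0 < r" "0 < s" "r\<^sup>2 = tangent_power (m - d)" "s\<^sup>2 = tangent_power (m + d)"
    using tangent_power_pos[of "m - d"] tangent_power_pos[of "m + d"] by (simp_all add: r_def s_def)
  have uv: "0 < u $ 3" "0 < v $ 3"
    using arc_vec_pos by (simp_all add: u_def v_def)
  have forms: "u \<bullet> (C *v u) = r * r" "v \<bullet> (C *v v) = s * s" "u \<bullet> (C *v v) = - (r * s)"
      "v \<bullet> (C *v u) = - (r * s)"
  proof -
    show "u \<bullet> (C *v u) = r * r" "v \<bullet> (C *v v) = s * s"
      using r by (simp_all add: u_def v_def arc_vec_def C_emb tangent_power_def power2_eq_square)
    show "u \<bullet> (C *v v) = - (r * s)"
      using tangent_chord_polar_form[OF assms]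
      by (simp add: u_def v_def arc_vec_def C_emb polar_form_def r_def s_def real_sqrt_mult)
    then show "v \<bullet> (C *v u) = - (r * s)"
      using symmetric_form_commute[OF symmetric(2)] by metis
  qed
  define q where "q = s *\<^sub>R u + r *\<^sub>R v"
  have q3: "q $ 3 > 0"
    using r uv by (simp add: q_def add_pos_pos)
  have uq: "u \<bullet> (C *v q) = 0" and vq: "v \<bullet> (C *v q) = 0"
    by (simp_all add: q_def matrix_vector_right_distrib matrix_vector_mult_scaleR inner_add forms)
  then have qq: "q \<bullet> (C *v q) = 0"
    by (simp add: q_def inner_add_left)
  have "proj q \<in> closed_segment (proj u) (proj v)"
    unfolding q_def using uv r by (intro proj_in_segment) auto
  moreover have "proj q \<in> conic_curve C"
    using q3 qq by (simp add: conic_curve_def homog_proj matrix_vector_mult_scaleR)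
  moreover have "{proj u, proj v} \<subseteq> tangent_line C (proj q)"
    using uv q3 uq vq by (simp add: tangent_line_def homog_proj matrix_vector_mult_scaleR)
  moreover have "proj u \<noteq> proj v"
  proof
    assume "proj u = proj v"
    then obtain n :: int where "m - d = m + d + 2 * pi * n"
      using arc_pt_eq_iff[of "m - d" "m + d"] by (auto simp: arc_pt_def u_def v_def)
    then have "d = pi * of_int (- n)"
      by simp
    moreover have "0 < d" "d < pi * 1"
      using assms pi_gt_zero by (auto simp: tangent_chord_def)
    ultimately have "0 < pi * real_of_int (- n)" "pi * real_of_int (- n) < pi * 1"
      by simp_all
    then have "0 < real_of_int (- n)" "real_of_int (- n) < 1"
      using pi_gt_zero mult_less_cancel_left_pos zero_less_mult_pos by blast+
    then have "0 < - n" "- n < 1"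
      by (simp_all only: of_int_0_less_iff of_int_less_1_iff)
    then show False
      by simp
  qed
  ultimately show ?thesis
    unfolding segment_tangent_to_def arc_pt_def u_def v_def by blast
qed

text \<open>
  By the Cauchy-Schwarz inequality \<open>x cos m + y sin m\<close> is at most the support function \<open>w cos d\<close> on the
  ellipse, so the ellipse is on the side of the centre, and that side is on the left of a chord with
  increasing angle.
\<close>

lemma tangent_chord_on_left:
  assumes "tangent_chord m d"
  shows "on_left (arc_pt (m - d)) (arc_pt (m + d)) (conic_curve C)"
  unfolding on_left_def
proof
  fix p assume "p \<in> conic_curve C"
  then obtain x y w where xyw: "homog p = emb x y w" and eq: "a * x\<^sup>2 + b * y\<^sup>2 = c * w\<^sup>2"
      and lt: "x\<^sup>2 + y\<^sup>2 < w\<^sup>2"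
    by (rule conic_C_inside)
  have w: "w > 0"
    using emb_eq_homog_pos[OF xyw] lt by simp
  have d: "0 < sin d" "0 < cos d"
    using assms by (auto simp: tangent_chord_def intro!: sin_gt_zero cos_gt_zero)
  have "(x * cos m + y * sin m)\<^sup>2 \<le> (a * x\<^sup>2 + b * y\<^sup>2) * ((cos m)\<^sup>2 / a + (sin m)\<^sup>2 / b)"
  proof -
    have "(a * x\<^sup>2 + b * y\<^sup>2) * ((cos m)\<^sup>2 / a + (sin m)\<^sup>2 / b) - (x * cos m + y * sin m)\<^sup>2
        = (a * x * sin m - b * y * cos m)\<^sup>2 / (a * b)"
      using pos by (simp add: field_simps power2_eq_square)
    also have "\<dots> \<ge> 0"
      using pos by simp
    finally show ?thesis
      by simp
  qed
  also have "\<dots> = (w * cos d)\<^sup>2"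
    using assms by (simp add: eq tangent_chord_def power_mult_distrib)
  finally have le: "x * cos m + y * sin m \<le> w * cos d"
    by (rule power2_le_imp_le) (use w d in simp)
  let ?u = "arc_vec (m - d)" and ?v = "arc_vec (m + d)"
  have "Im (cnj (arc_pt (m + d) - arc_pt (m - d)) * (p - arc_pt (m - d)))
      = triple ?u ?v (homog p) / (?u $ 3 * ?v $ 3)"
    unfolding cross_eq_triple homog_arc_pt
    using triple_scaleR[of "1 / ?u $ 3" ?u "1 / ?v $ 3" ?v 1 "homog p"] by simp
  also have "triple ?u ?v (homog p) = triple v1 v2 v3 * (2 * sin d * (w * cos d - (x * cos m + y * sin m)))"
    unfolding arc_vec_def xyw triple_emb
  proof (rule arg_cong[of _ _ "(*) (triple v1 v2 v3)"])
    have "triple (vector [cos (m - d), sin (m - d), 1]) (vector [cos (m + d), sin (m + d), 1]) (vector [x, y, w])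
        = w * sin ((m + d) - (m - d)) - x * (sin (m + d) - sin (m - d)) - y * (cos (m - d) - cos (m + d))"
      unfolding sin_diff[of "m + d" "m - d"] by (simp add: triple_altdef algebra_simps)
    also have "\<dots> = 2 * sin d * (w * cos d - (x * cos m + y * sin m))"
      using sin_double[of d] by (simp add: sin_add sin_diff cos_add cos_diff algebra_simps)
    finally show "triple (vector [cos (m - d), sin (m - d), 1]) (vector [cos (m + d), sin (m + d), 1]) (vector [x, y, w])
        = 2 * sin d * (w * cos d - (x * cos m + y * sin m))" .
  qed
  finally show "0 \<le> Im (cnj (arc_pt (m + d) - arc_pt (m - d)) * (p - arc_pt (m - d)))"
    using le d frame_positive arc_vec_pos[of "m - d"] arc_vec_pos[of "m + d"] by simp
qed

lemma poncelet_map_tangent_chord: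
  assumes "tangent_chord m d"
  shows "poncelet_map A C (arc_pt (m - d)) = arc_pt (m + d)"
  unfolding poncelet_map_def
  using arc_pt_in_conic tangent_chord_touches[OF assms] tangent_chord_on_left[OF assms]
  by (intro the_equality) (auto intro: left_tangent_unique)

lemma poncelet_rotation_number:
  defines "e \<equiv> sqrt ((a - b) / (a - c))" and "\<omega> \<equiv> arcsin (sqrt ((a - c) / a))"
  shows "has_rotation_number (conic_curve A) (poncelet_map A C) (elliptic_F \<omega> e / (2 * elliptic_K e))"
proof (rule has_rotation_number_of_rotation_coordinate[OF ccw_parametrization_arc_pt])
  have e: "e\<^sup>2 < 1"
    using b_less_a c_less_b pos by (simp add: e_def)
  note K = elliptic_K_pos[OF e]
  let ?B = "\<lambda>t. elliptic_F (2 * pi * t) e / (4 * elliptic_K e)"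
  show "continuous_on UNIV ?B"
    using K by (intro continuous_on_divide continuous_on_compose2[OF continuous_on_elliptic_F[OF e]]
        continuous_intros) auto
  show "strict_mono ?B"
    using K strict_monoD[OF strict_mono_elliptic_F[OF e]]
    by (intro strict_monoI divide_strict_right_mono) auto
  show "?B (t + 1) = ?B t + 1" for t
    using elliptic_F_add_2pi[OF e, of "2 * pi * t"] K by (simp add: distrib_left add_divide_distrib)
  have "- 1 \<le> sqrt ((a - c) / a)"
    by (rule order_trans[of _ 0]) (use pos in auto)
  then have "0 < \<omega>" "\<omega> < pi / 2"
    using arcsin_less_arcsin[of 0 "sqrt ((a - c) / a)"] arcsin_less_arcsin[of "sqrt ((a - c) / a)" 1]
      pos c_pos by (simp_all add: \<omega>_def)
  then have "0 < elliptic_F \<omega> e" "elliptic_F \<omega> e < elliptic_K e"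
    using strict_monoD[OF strict_mono_elliptic_F[OF e], of 0 \<omega>]
      strict_monoD[OF strict_mono_elliptic_F[OF e], of \<omega> "pi / 2"] by (simp_all add: elliptic_K_def)
  then show "0 \<le> elliptic_F \<omega> e / (2 * elliptic_K e)" "elliptic_F \<omega> e / (2 * elliptic_K e) < 1"
    using K by simp_all
  show "poncelet_map A C (arc_pt (2 * pi * t)) = arc_pt (2 * pi * s)"
    if "?B s = ?B t + elliptic_F \<omega> e / (2 * elliptic_K e)" for s t
  proof -
    obtain m where m: "m - half_angle m = 2 * pi * t"
      using ex_tangent_chord_from by blast
    have "elliptic_F (2 * pi * s) e = elliptic_F (2 * pi * t) e + 2 * elliptic_F \<omega> e"
      using that K by (simp add: field_simps)
    also have "\<dots> = elliptic_F (m + half_angle m) e"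
      using elliptic_F_tangent_chord[of m] by (simp add: m e_def \<omega>_def)
    finally have "2 * pi * s = m + half_angle m"
      using strict_mono_eq[OF strict_mono_elliptic_F[OF e]] by simp
    then show ?thesis
      using poncelet_map_tangent_chord[OF tangent_chord_half_angle[of m]] by (simp add: m)
  qed
qed

end

section \<open>The common self-polar triangle of the pencil\<close>

lemma positive_definite_upper_left_block:
  assumes "positive_definite (upper_left_block A)" and "u \<noteq> 0" and "u $ 3 = 0"
  shows "u \<bullet> (A *v u) > 0"
proof -
  define v :: "real ^ 2" where "v = vector [u $ 1, u $ 2]"
  have "v \<noteq> 0"
    using assms(2,3) by (auto simp: v_def vec_eq_iff forall_3 forall_2)
  moreover have "v \<bullet> (upper_left_block A *v v) = u \<bullet> (A *v u)"
    using assms(3)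
    by (simp add: v_def upper_left_block_def inner_vec_def matrix_vector_mult_def sum_2 sum_3)
  ultimately show ?thesis
    using assms(1) by (metis positive_definite_def)
qed

lemma gram_determinant:
  fixes A :: "real ^ 3 ^ 3"
  assumes "u \<bullet> (A *v v) = 0" "u \<bullet> (A *v w) = 0" "v \<bullet> (A *v u) = 0"
    "v \<bullet> (A *v w) = 0" "w \<bullet> (A *v u) = 0" "w \<bullet> (A *v v) = 0"
  shows "(u \<bullet> (A *v u)) * (v \<bullet> (A *v v)) * (w \<bullet> (A *v w)) = det A * (triple u v w)\<^sup>2"
proof -
  define R :: "real ^ 3 ^ 3" where "R = vector [u, v, w]"
  have R: "R $ 1 = u" "R $ 2 = v" "R $ 3 = w"
    by (simp_all add: R_def)
  have entry: "(R ** (A ** transpose R)) $ i $ j = R $ i \<bullet> (A *v R $ j)" for i j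
    by (simp add: matrix_matrix_mult_def matrix_vector_mult_def inner_vec_def transpose_def)
  have "det (R ** (A ** transpose R)) = (u \<bullet> (A *v u)) * (v \<bullet> (A *v v)) * (w \<bullet> (A *v w))"
    unfolding det_3 entry R using assms by simp
  moreover have "det (R ** (A ** transpose R)) = det A * (triple u v w)\<^sup>2"
    by (simp add: det_mul det_transpose triple_def R_def power2_eq_square)
  ultimately show ?thesis
    by simp
qed

lemma eigenvector_of_pencil:
  assumes "det A \<noteq> 0" and "eigenvalue (matrix_inv A ** B) l"
  obtains v where "v \<noteq> 0" and "B *v v = l *\<^sub>R (A *v v)"
proof -
  obtain v where v: "v \<noteq> 0" "(matrix_inv A ** B) *v v = l *\<^sub>R v"
    using assms(2) by (auto simp: eigenvalue_def)
  have "A ** matrix_inv A = mat 1"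
    using assms(1) someI_ex[of "\<lambda>A'. A ** A' = mat 1 \<and> A' ** A = mat 1"]
    unfolding matrix_inv_def invertible_det_nz[symmetric] invertible_def by blast
  then have "B *v v = A *v ((matrix_inv A ** B) *v v)"
    by (simp add: matrix_vector_mul_assoc matrix_mul_assoc)
  also have "\<dots> = l *\<^sub>R (A *v v)"
    by (simp add: v(2) matrix_vector_mult_scaleR)
  finally show ?thesis
    using that v(1) by blast
qed

text \<open>
  Eigenvectors for distinct eigenvalues are orthogonal for both forms, and the inclusion of the conics
  prevents them from being isotropic, so they can be normalized. The form \<open>C1\<close> is positive on a plane
  and has negative determinant, hence exactly one of the three vectors is negative. It belongs to the
  smallest eigenvalue: if \<open>u\<close> were negative with eigenvalue \<open>k\<close> and \<open>v\<close> positive with \<open>k' < k\<close>, the plane of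
  \<open>u\<close> and \<open>v\<close> would contain an isotropic vector of \<open>C2\<close> on which \<open>C1\<close> is positive.
\<close>

lemma self_polar_triangle_exists:
  fixes C1 C2 :: "real ^ 3 ^ 3"
  assumes sym: "transpose C1 = C1" "transpose C2 = C2"
    and pd: "positive_definite (upper_left_block C1)" and det: "det C1 < 0"
    and eig: "{l. eigenvalue (matrix_inv C1 ** C2) l} = {l1, l2, l3}"
    and l: "l1 > l2" "l2 > l3" "l3 > 0"
    and inside: "\<And>u. u \<noteq> 0 \<Longrightarrow> u \<bullet> (C2 *v u) = 0 \<Longrightarrow> u \<bullet> (C1 *v u) < 0"
  obtains v1 v2 v3 where
    "C2 *v v1 = l1 *\<^sub>R (C1 *v v1)" "C2 *v v2 = l2 *\<^sub>R (C1 *v v2)" "C2 *v v3 = l3 *\<^sub>R (C1 *v v3)"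
    and "v1 \<bullet> (C1 *v v1) = 1" "v2 \<bullet> (C1 *v v2) = 1" "v3 \<bullet> (C1 *v v3) = - 1"
    and "v1 \<bullet> (C1 *v v2) = 0" "v1 \<bullet> (C1 *v v3) = 0" "v2 \<bullet> (C1 *v v3) = 0"
    and "v3 $ 3 > 0" and "triple v1 v2 v3 > 0"
proof -
  define Q where "Q u w = u \<bullet> (C1 *v w)" for u w
  have Q_sym: "Q u w = Q w u" for u w
    unfolding Q_def by (rule symmetric_form_commute[OF sym(1)])
  have Q_lin: "Q (u + u') w = Q u w + Q u' w" "Q u (w + w') = Q u w + Q u w'"
      "Q (r *\<^sub>R u) w = r * Q u w" "Q u (r *\<^sub>R w) = r * Q u w"
      "Q (u - u') w = Q u w - Q u' w" "Q u (w - w') = Q u w - Q u w'" for u u' w w' r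
    by (simp_all add: Q_def inner_add inner_diff matrix_vector_mult_diff_distrib matrix_vector_right_distrib matrix_vector_mult_scaleR)
  have Q_pos: "Q u u > 0" if "u \<noteq> 0" "u $ 3 = 0" for u
    unfolding Q_def using positive_definite_upper_left_block[OF pd that] .
  have "eigenvalue (matrix_inv C1 ** C2) l1" "eigenvalue (matrix_inv C1 ** C2) l2"
      "eigenvalue (matrix_inv C1 ** C2) l3"
    using eig by blast+
  then obtain w1 w2 w3 where w: "w1 \<noteq> 0" "w2 \<noteq> 0" "w3 \<noteq> 0"
      "C2 *v w1 = l1 *\<^sub>R (C1 *v w1)" "C2 *v w2 = l2 *\<^sub>R (C1 *v w2)" "C2 *v w3 = l3 *\<^sub>R (C1 *v w3)"
    using eigenvector_of_pencil[of C1 C2] det by (metis less_irrefl)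
  have orth: "Q u v = 0"
    if "C2 *v u = k *\<^sub>R (C1 *v u)" "C2 *v v = k' *\<^sub>R (C1 *v v)" "k \<noteq> k'" for u v k k'
  proof -
    have "k' * Q u v = u \<bullet> (C2 *v v)"
      by (simp add: Q_def that(2))
    also have "\<dots> = v \<bullet> (C2 *v u)"
      by (rule symmetric_form_commute[OF sym(2)])
    also have "\<dots> = k * Q u v"
      using Q_sym[of u v] by (simp add: Q_def that(1))
    finally show ?thesis
      using that(3) by simp
  qed
  have nz: "Q u u \<noteq> 0" if "C2 *v u = k *\<^sub>R (C1 *v u)" "u \<noteq> 0" for u k
  proof
    assume "Q u u = 0"
    then have "u \<bullet> (C2 *v u) = 0"
      by (simp add: that(1) Q_def)
    then show False
      using inside[OF that(2)] \<open>Q u u = 0\<close> by (simp add: Q_def)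
  qed
  have one_negative: "\<not> (Q u u < 0 \<and> Q v v < 0)" if "Q u v = 0" for u v
  proof
    assume neg: "Q u u < 0 \<and> Q v v < 0"
    have u3: "u $ 3 \<noteq> 0"
      using neg Q_pos[of u] by (cases "u = 0") (auto simp: Q_def)
    \<comment> \<open>The plane spanned by \<open>u\<close> and \<open>v\<close> meets the plane at infinity, where the form is positive.\<close>
    define t where "t = v $ 3 *\<^sub>R u + (- u $ 3) *\<^sub>R v"
    have Qt: "Q t t = (v $ 3)\<^sup>2 * Q u u + (u $ 3)\<^sup>2 * Q v v"
      using that Q_sym[of v u] by (simp add: t_def Q_lin power2_eq_square)
    have "(v $ 3)\<^sup>2 * Q u u \<le> 0" "(u $ 3)\<^sup>2 * Q v v < 0"
      using neg u3 by (simp_all add: mult_nonneg_nonpos mult_pos_neg)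
    then have "Q t t < 0"
      using Qt by linarith
    moreover have "t $ 3 = 0"
      by (simp add: t_def)
    ultimately show False
      using Q_pos[of t] by (cases "t = 0") (auto simp: Q_def)
  qed
  have larger_eigenvalue_positive: "Q u u > 0"
    if u: "C2 *v u = k *\<^sub>R (C1 *v u)" "u \<noteq> 0" "k > k'" and v: "C2 *v v = k' *\<^sub>R (C1 *v v)" "v \<noteq> 0" "k' > 0"
    for u v k k'
  proof (rule ccontr)
    assume "\<not> Q u u > 0"
    then have un: "Q u u < 0"
      using nz[OF u(1,2)] by simp
    have ort: "Q u v = 0"
      using orth[OF u(1) v(1)] u(3) by simp
    then have vp: "Q v v > 0"
      using one_negative[OF ort] un nz[OF v(1,2)] by linarith
    \<comment> \<open>Coefficients for which \<open>p u + q v\<close> is isotropic for \<open>C2\<close>.\<close>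
    define p where "p = sqrt (k' * Q v v)"
    define q where "q = sqrt (- k * Q u u)"
    have "k * Q u u < 0"
      using un u(3) v(3) by (intro mult_pos_neg) auto
    then have pq: "p\<^sup>2 = k' * Q v v" "q\<^sup>2 = - k * Q u u"
      using vp v(3) by (simp_all add: p_def q_def)
    define t where "t = p *\<^sub>R u + q *\<^sub>R v"
    have "t \<bullet> (C2 *v t) = p\<^sup>2 * (k * Q u u) + q\<^sup>2 * (k' * Q v v)"
      using ort Q_sym[of v u]
      by (simp add: t_def matrix_vector_right_distrib matrix_vector_mult_scaleR inner_add u(1) v(1)
          power2_eq_square Q_lin flip: Q_def)
    also have "\<dots> = 0"
      unfolding pq by simp
    finally have "t \<bullet> (C2 *v t) = 0" .
    moreover have Qt: "Q t t = p\<^sup>2 * Q u u + q\<^sup>2 * Q v v"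
      using ort Q_sym[of v u] by (simp add: t_def Q_lin power2_eq_square)
    then have Qt': "Q t t = (k' - k) * (Q u u * Q v v)"
      unfolding pq by (simp add: algebra_simps)
    have "Q t t > 0"
      unfolding Qt' using un vp u(3) by (intro mult_neg_neg) (simp_all add: mult_neg_pos)
    moreover from this have "t \<noteq> 0"
      by (auto simp: Q_def)
    ultimately show False
      using inside[of t] by (simp add: Q_def)
  qed
  have w1: "Q w1 w1 > 0" and w2: "Q w2 w2 > 0"
    using larger_eigenvalue_positive[OF w(4,1) _ w(6,3)] larger_eigenvalue_positive[OF w(5,2) _ w(6,3)] l by simp_all
  have ort: "Q w1 w2 = 0" "Q w1 w3 = 0" "Q w2 w3 = 0"
    using orth[OF w(4,5)] orth[OF w(4,6)] orth[OF w(5,6)] l by simp_all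
  have gram: "Q w1 w1 * Q w2 w2 * Q w3 w3 = det C1 * (triple w1 w2 w3)\<^sup>2"
    unfolding Q_def by (rule gram_determinant; fold Q_def) (use ort Q_sym in metis)+
  have "Q w1 w1 * Q w2 w2 * Q w3 w3 \<noteq> 0"
    using w1 w2 nz[OF w(6,3)] by simp
  then have triple: "triple w1 w2 w3 \<noteq> 0"
    using gram by auto
  then have "Q w1 w1 * Q w2 w2 * Q w3 w3 < 0"
    unfolding gram using det by (simp add: mult_neg_pos)
  then have w3: "Q w3 w3 < 0"
    using w1 w2 by (auto simp: mult_less_0_iff)
  have w33: "w3 $ 3 \<noteq> 0"
    using Q_pos[of w3] w(3) w3 by force
  \<comment> \<open>Besides normalizing, the signs make the weight of \<open>v3\<close> and then the orientation positive.\<close>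
  define r3 where "r3 = sgn (w3 $ 3) / sqrt (- Q w3 w3)"
  define r2 where "r2 = 1 / sqrt (Q w2 w2)"
  define r1 where "r1 = sgn (triple w1 w2 w3) * sgn r3 / sqrt (Q w1 w1)"
  have r3: "r3 * (r3 * Q w3 w3) = - 1" "r3 \<noteq> 0" "r3 * w3 $ 3 > 0"
    using w3 w33 by (auto simp: r3_def sgn_if field_simps zero_less_divide_iff mult_less_0_iff divide_less_0_iff)
  have r2: "r2 * (r2 * Q w2 w2) = 1" "r2 > 0"
    using w2 by (auto simp: r2_def field_simps)
  have r1: "r1 * (r1 * Q w1 w1) = 1"
    using w1 triple r3(2) by (auto simp: r1_def sgn_if field_simps)
  have "r1 * r2 * r3 * triple w1 w2 w3
      = \<bar>triple w1 w2 w3\<bar> * \<bar>r3\<bar> * r2 * (1 / sqrt (Q w1 w1))"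
    by (simp add: r1_def abs_sgn)
  also have "\<dots> > 0"
    using triple r3(2) r2(2) w1 by simp
  finally have orientation: "r1 * r2 * r3 * triple w1 w2 w3 > 0" .
  show ?thesis
  proof (rule that[of "r1 *\<^sub>R w1" "r2 *\<^sub>R w2" "r3 *\<^sub>R w3"]; (fold Q_def)?)
    show "triple (r1 *\<^sub>R w1) (r2 *\<^sub>R w2) (r3 *\<^sub>R w3) > 0"
      using orientation by (simp add: triple_altdef algebra_simps)
  qed (use r1 r2 r3 ort w in \<open>simp_all add: Q_lin matrix_vector_mult_scaleR\<close>)
qed

section \<open>The rotation number of the Poncelet map\<close>

theorem theorem2:
  fixes C1 C2 :: "real ^ 3 ^ 3"
    and l\<^sub>1 l\<^sub>2 l\<^sub>3 \<nu>\<^sub>1 \<nu>\<^sub>2 e \<omega> :: real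
  assumes "transpose C1 = C1" and "transpose C2 = C2"
    and "positive_definite (upper_left_block C1)" and "det C1 < 0"
    and "positive_definite (upper_left_block C2)" and "det C2 < 0"
    and "{l. eigenvalue (matrix_inv C1 ** C2) l} = {l\<^sub>1, l\<^sub>2, l\<^sub>3}"
    and "l\<^sub>1 > l\<^sub>2" and "l\<^sub>2 > l\<^sub>3" and "l\<^sub>3 > 0"
    and "\<And>u. u \<noteq> 0 \<Longrightarrow> u \<bullet> (C2 *v u) = 0 \<Longrightarrow> u \<bullet> (C1 *v u) < 0"
    and "e = sqrt ((l\<^sub>1 - l\<^sub>2) / (l\<^sub>1 - l\<^sub>3))"
    and "\<nu>\<^sub>2 > 0" and "\<nu>\<^sub>1 + l\<^sub>3 * \<nu>\<^sub>2 > 0"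
    and "\<omega> = arcsin (sqrt ((l\<^sub>1 - l\<^sub>3) * \<nu>\<^sub>2 / (l\<^sub>1 * \<nu>\<^sub>2 + \<nu>\<^sub>1)))"
  shows "has_rotation_number (conic_curve C1) (poncelet_map C1 (\<nu>\<^sub>1 *\<^sub>R C1 + \<nu>\<^sub>2 *\<^sub>R C2))
           (elliptic_F \<omega> e / (2 * elliptic_K e))"
proof -
  obtain v1 v2 v3 where
    eig: "C2 *v v1 = l\<^sub>1 *\<^sub>R (C1 *v v1)" "C2 *v v2 = l\<^sub>2 *\<^sub>R (C1 *v v2)" "C2 *v v3 = l\<^sub>3 *\<^sub>R (C1 *v v3)"
    and diag: "v1 \<bullet> (C1 *v v1) = 1" "v2 \<bullet> (C1 *v v2) = 1" "v3 \<bullet> (C1 *v v3) = - 1"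
    and orth: "v1 \<bullet> (C1 *v v2) = 0" "v1 \<bullet> (C1 *v v3) = 0" "v2 \<bullet> (C1 *v v3) = 0"
    and "v3 $ 3 > 0" and "triple v1 v2 v3 > 0"
    using self_polar_triangle_exists[OF assms(1,2,3,4,7,8,9,10,11)] by blast
  define a where "a = l\<^sub>1 * \<nu>\<^sub>2 + \<nu>\<^sub>1"
  define b where "b = l\<^sub>2 * \<nu>\<^sub>2 + \<nu>\<^sub>1"
  define c where "c = l\<^sub>3 * \<nu>\<^sub>2 + \<nu>\<^sub>1"
  define C where "C = \<nu>\<^sub>1 *\<^sub>R C1 + \<nu>\<^sub>2 *\<^sub>R C2"
  have C_eig: "C *v v1 = a *\<^sub>R (C1 *v v1)" "C *v v2 = b *\<^sub>R (C1 *v v2)" "C *v v3 = c *\<^sub>R (C1 *v v3)"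
    unfolding C_def a_def b_def c_def
    by (simp_all add: matrix_vector_mult_add_rdistrib eig algebra_simps flip: scaleR_matrix_vector_assoc)
  interpret self_polar_frame a b c C1 C v1 v2 v3
  proof
    show "transpose C = C"
      using assms(1,2) by (simp add: C_def transpose_def vec_eq_iff)
    show "u \<bullet> (C1 *v u) > 0" if "u \<noteq> 0" "u $ 3 = 0" for u
      using positive_definite_upper_left_block[OF assms(3) that] .
    show "0 < c" "c < b" "b < a"
      using assms by (simp_all add: a_def b_def c_def)
  qed (use assms diag orth C_eig \<open>v3 $ 3 > 0\<close> \<open>triple v1 v2 v3 > 0\<close> in simp_all)
  have differences: "a - b = (l\<^sub>1 - l\<^sub>2) * \<nu>\<^sub>2" "a - c = (l\<^sub>1 - l\<^sub>3) * \<nu>\<^sub>2"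
    by (simp_all add: a_def b_def c_def algebra_simps)
  have "sqrt ((a - b) / (a - c)) = e"
    using assms(13) by (simp add: differences assms(12))
  moreover have "arcsin (sqrt ((a - c) / a)) = \<omega>"
    unfolding differences assms(15) by (simp add: a_def)
  ultimately show ?thesis
    using poncelet_rotation_number unfolding C_def by simp
qed

end
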